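(* Let $d\geq 1$ and $n\geq 0$ be integers, and let $X(d,n+d+1)\subset\bigwedge^d(\mathbb{C}^{n+d+1})$ be the affine cone over the Grassmannian $Gr(d,n+d+1)$ in its Plücker embedding (the set of decomposable vectors $v_1\wedge\cdots\wedge v_d$). Let $\mathbb{C}[X(d,n+d+1)]$ be its coordinate ring (the polynomial ring on $\bigwedge^d(\mathbb{C}^{n+d+1})$ modulo the vanishing ideal of $X(d,n+d+1)$), graded by degree, with Hilbert series $h_{\mathbb{C}[X(d,n+d+1)]}(t)$. Let $\partial_t$ be the operator $f(t)\mapsto f'(t)$ and $T$ the operator $f(t)\mapsto tf(t)$ on formal power series in $t$. Then $$h_{\mathbb{C}[X(d,n+d+1)]}(t)=\frac{(\partial_t^d\circ T^{d-1})^n\left[(1-t)^{-(d+1)}\right]}{\prod_{i=1}^d\prod_{j=1}^n(i+j)}.$$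
   Context: The Hilbert series of a graded algebra $R=\bigoplus_{k\geq0}R_k$ with finite-dimensional graded pieces is $h_R(t)=\sum_{k\geq 0}\dim(R_k)t^k$. Here $(1-t)^{-(d+1)}$ is regarded as a formal power series in $t$. *)

theory Defs
  imports "HOL-Combinatorics.Combinatorics" "HOL-Computational_Algebra.Formal_Power_Series"
begin

definition plucker_index :: "nat \<Rightarrow> nat \<Rightarrow> nat set set" where
  "plucker_index d N = {S. S \<subseteq> {0..<N} \<and> card S = d}"

text \<open>The Plucker coordinate of v_0 wedge ... wedge v_(d-1) at the subset S:
the d x d minor with columns the elements of S in increasing order
(Leibniz formula). Here v i j is the j-th coordinate of the i-th vector.\<close>
definition plucker_coord :: "nat \<Rightarrow> (nat \<Rightarrow> nat \<Rightarrow> complex) \<Rightarrow> nat set \<Rightarrow> complex" where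
  "plucker_coord d v S =
     (\<Sum>\<sigma> | \<sigma> permutes {0..<d}.
        of_int (sign \<sigma>) * (\<Prod>i<d. v i (sorted_list_of_set S ! (\<sigma> i))))"

definition grass_cone :: "nat \<Rightarrow> nat \<Rightarrow> (nat set \<Rightarrow> complex) set" where
  "grass_cone d N = {p. \<exists>v. \<forall>S. p S = (if S \<in> plucker_index d N then plucker_coord d v S else 0)}"

definition monomials :: "nat \<Rightarrow> nat \<Rightarrow> nat \<Rightarrow> (nat set \<Rightarrow> nat) set" where
  "monomials d N k = {\<alpha>. (\<forall>S. S \<notin> plucker_index d N \<longrightarrow> \<alpha> S = 0)
                          \<and> (\<Sum>S\<in>plucker_index d N. \<alpha> S) = k}"

definition eval_monomial :: "nat \<Rightarrow> nat \<Rightarrow> (nat set \<Rightarrow> nat) \<Rightarrow> (nat set \<Rightarrow> complex) \<Rightarrow> complex" where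
  "eval_monomial d N \<alpha> p = (\<Prod>S\<in>plucker_index d N. p S ^ \<alpha> S)"

definition lin_indep_on :: "nat \<Rightarrow> nat \<Rightarrow> (nat set \<Rightarrow> complex) set \<Rightarrow> (nat set \<Rightarrow> nat) set \<Rightarrow> bool" where
  "lin_indep_on d N X M \<longleftrightarrow>
     (\<forall>c. (\<forall>p\<in>X. (\<Sum>\<alpha>\<in>M. c \<alpha> * eval_monomial d N \<alpha> p) = 0) \<longrightarrow> (\<forall>\<alpha>\<in>M. c \<alpha> = 0))"

text \<open>Degree-k piece of the coordinate ring C[X] = C[V]/I(X): since X is a cone, I(X) is
homogeneous and R_k is the space of restrictions to X of homogeneous degree-k polynomials,
i.e. the span of the restricted degree-k monomials. Its dimension is the maximal size
of a linearly independent (on X) set of degree-k monomials.\<close>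
definition coord_ring_dim :: "nat \<Rightarrow> nat \<Rightarrow> nat \<Rightarrow> nat" where
  "coord_ring_dim d N k =
     Max {card M | M. M \<subseteq> monomials d N k \<and> lin_indep_on d N (grass_cone d N) M}"

definition hilbert_series_grass :: "nat \<Rightarrow> nat \<Rightarrow> complex fps" where
  "hilbert_series_grass d N = Abs_fps (\<lambda>k. of_nat (coord_ring_dim d N k))"

end

theory Submission
  imports Defs "Jordan_Normal_Form.Determinant"
begin

text \<open>
  The degree-\<open>k\<close> piece of the coordinate ring is the span of the products of \<open>k\<close> maximal minors of
  a generic \<open>d \<times> N\<close> matrix. Its dimension is the number of exponent matrices \<open>A\<close> with all row sums
  \<open>k\<close> satisfying the ballot condition (equivalently, of semistandard tableaux of shape \<open>d \<times> k\<close> with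
  entries below \<open>N\<close>).

  Upper bound, without straightening: a combination of such products is unchanged when a multiple
  of row \<open>r\<close> is added to row \<open>r + 1\<close>, hence its coefficients are annihilated by the operator
  \<open>\<Sum>l. x (r, l) \<partial>/\<partial>x (r + 1, l)\<close>. For a suitable weight, an exponent of maximal weight in the
  support must then be ballot; this is an instance of the injectivity part of the hard Lefschetz
  property of a product of chains. So a combination whose ballot coefficients vanish is zero.

  Lower bound: every ballot matrix is the diagonal (leading) exponent of a product of minors.

  Count: peeling off the last column gives the branching rule, which the Jacobi-Trudi determinants
  at \<open>(1, \<dots>, 1)\<close> satisfy by telescoping. For the rectangle the determinant is evaluated through
  two triangular factorizations coming from Vandermonde's convolution.
\<close>

section \<open>A Lefschetz-type bound on products of chains\<close>

text \<open>On \<open>{..c}\<close> the left side is a polynomial in \<open>b\<close> of degree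
  \<open>m\<close>, and the binomials \<open>b choose s\<close> with \<open>s \<le> m\<close> span
  those. The bound \<open>b \<le> c\<close> keeps the natural number difference \<open>c - b\<close>
  from being truncated.\<close>

lemma choose_diff_expansion:
  "\<exists>a :: nat \<Rightarrow> 'a :: field_char_0.
     \<forall>b\<le>c. of_nat ((c - b) choose m) = (\<Sum>s\<le>m. a s * of_nat (b choose s))"
proof (induction m)
  case 0
  show ?case by (rule exI[of _ "\<lambda>_. 1"]) simp
next
  case (Suc m)
  then obtain a :: "nat \<Rightarrow> 'a"
    where a: "\<And>b. b \<le> c \<Longrightarrow> of_nat ((c - b) choose m) = (\<Sum>s\<le>m. a s * of_nat (b choose s))"
    by blast
  \<comment> \<open>Split \<open>c - b - m\<close> as \<open>(c - m - s) - (b - s)\<close>: the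
    first summand keeps \<open>b choose s\<close>, the second turns it into a multiple of
    \<open>b choose Suc s\<close>.\<close>
  define a1 where "a1 s = (if s \<le> m then a s * (of_nat c - of_nat m - of_nat s) else 0)" for s
  define a2 where "a2 s = (if s = 0 then 0 else a (s - 1) * of_nat s)" for s
  have step: "of_nat ((c - b) choose Suc m) =
      (\<Sum>s\<le>Suc m. (a1 s - a2 s) / of_nat (Suc m) * of_nat (b choose s))" if b: "b \<le> c" for b
  proof -
    have "of_nat (Suc m) * of_nat ((c - b) choose Suc m) =
        (of_nat ((c - b) choose m) :: 'a) * (of_nat c - of_nat b - of_nat m)"
    proof (cases "m \<le> c - b")
      case True
      have "Suc m * ((c - b) choose Suc m) = ((c - b) choose m) * (c - b - m)"
        using binomial_absorb_comp[of "c - b" m] binomial_absorption[of m "c - b"]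
        by (cases "c - b") (auto simp: mult.commute)
      then have "of_nat (Suc m) * of_nat ((c - b) choose Suc m) =
          (of_nat ((c - b) choose m) :: 'a) * of_nat (c - b - m)"
        by (metis of_nat_mult)
      also have "of_nat (c - b - m) = (of_nat c - of_nat b - of_nat m :: 'a)"
        using True b by (simp add: of_nat_diff)
      finally show ?thesis .
    next
      case False
      then show ?thesis by (simp add: binomial_eq_0)
    qed
    also have "\<dots> = (\<Sum>s\<le>m. a s * (of_nat (b choose s) * (of_nat c - of_nat b - of_nat m)))"
      by (simp add: a[OF b] sum_distrib_right mult.assoc)
    also have "\<dots> = (\<Sum>s\<le>m. a s * ((of_nat c - of_nat m - of_nat s) * of_nat (b choose s)
                     - of_nat (Suc s) * of_nat (b choose Suc s)))"
    proof (intro sum.cong refl arg_cong2[where f = "(*)"])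
      fix s
      have "of_nat (Suc s) * of_nat (b choose Suc s) =
          (of_nat (b choose s) * (of_nat b - of_nat s) :: 'a)"
      proof (cases "s \<le> b")
        case True
        have "Suc s * (b choose Suc s) = (b choose s) * (b - s)"
          using binomial_absorb_comp[of b s] binomial_absorption[of s b]
          by (cases b) (auto simp: mult.commute)
        then have "of_nat (Suc s) * of_nat (b choose Suc s) =
            (of_nat (b choose s) * of_nat (b - s) :: 'a)"
          by (metis of_nat_mult)
        then show ?thesis using True by (simp add: of_nat_diff)
      next
        case False
        then show ?thesis by (simp add: binomial_eq_0)
      qed
      then show "of_nat (b choose s) * (of_nat c - of_nat b - of_nat m) =
          ((of_nat c - of_nat m - of_nat s) * of_nat (b choose s)
            - of_nat (Suc s) * of_nat (b choose Suc s) :: 'a)"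
        by (simp only:) (simp add: algebra_simps)
    qed
    also have "\<dots> = (\<Sum>s\<le>m. a1 s * of_nat (b choose s)) -
        (\<Sum>s\<le>m. a2 (Suc s) * of_nat (b choose Suc s))"
      unfolding sum_subtractf[symmetric]
      by (rule sum.cong) (auto simp: a1_def a2_def algebra_simps)
    also have "(\<Sum>s\<le>m. a1 s * of_nat (b choose s)) = (\<Sum>s\<le>Suc m. a1 s * of_nat (b choose s))"
      by (simp add: a1_def)
    also have "(\<Sum>s\<le>m. a2 (Suc s) * of_nat (b choose Suc s)) =
        (\<Sum>s\<le>Suc m. a2 s * of_nat (b choose s))"
      by (subst sum.atMost_Suc_shift) (simp add: a2_def)
    finally have "of_nat (Suc m) * of_nat ((c - b) choose Suc m) =
        (\<Sum>s\<le>Suc m. (a1 s - a2 s) * of_nat (b choose s))"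
      by (simp only: sum_subtractf[symmetric] left_diff_distrib)
    then have "of_nat ((c - b) choose Suc m) =
        (\<Sum>s\<le>Suc m. (a1 s - a2 s) * of_nat (b choose s)) / of_nat (Suc m)"
      by (simp only: eq_divide_eq mult.commute) (simp del: of_nat_Suc)
    then show ?thesis
      by (simp only: sum_divide_distrib times_divide_eq_left)
  qed
  show ?case
    by (rule exI[of _ "\<lambda>s. (a1 s - a2 s) / of_nat (Suc m)"], intro allI impI, rule step)
qed

text \<open>Read \<open>g b t\<close> as the coefficients of a polynomial in variables
  \<open>x l\<close> and \<open>y\<close>. By \<open>rel\<close> the sum of all partial derivatives
  kills it, so it depends only on the differences \<open>x l - y\<close> and is determined by its
  slice \<open>t = 0\<close>. The bound \<open>m\<close> on the degree in \<open>y\<close> makes low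
  binomial moments of that slice vanish; were the conclusion false, these moments would force the
  slice to be zero.\<close>

lemma lefschetz_bound:
  fixes g :: "('b \<Rightarrow> nat) \<Rightarrow> nat \<Rightarrow> 'a :: field_char_0"
  assumes fin: "finite J"
    and box: "\<And>b t. g b t \<noteq> 0 \<Longrightarrow> b \<in> (\<Pi>\<^sub>E l\<in>J. {..c l})"
    and deg: "\<And>b t. g b t \<noteq> 0 \<Longrightarrow> sum b J + t = D"
    and top: "\<And>b t. g b t \<noteq> 0 \<Longrightarrow> t \<le> m"
    and rel: "\<And>b t. b \<in> extensional J \<Longrightarrow>
       of_nat (Suc t) * g b (Suc t) + (\<Sum>l\<in>J. of_nat (Suc (b l)) * g (b(l := Suc (b l))) t) = 0"
    and nz: "g b0 m \<noteq> 0"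
  shows "D + sum b0 J \<le> sum c J"
proof (rule ccontr)
  assume contr: "\<not> D + sum b0 J \<le> sum c J"
  let ?Box = "\<Pi>\<^sub>E l\<in>J. {..c l}"
  define ch :: "('b \<Rightarrow> nat) \<Rightarrow> ('b \<Rightarrow> nat) \<Rightarrow> nat" where "ch b' b = (\<Prod>l\<in>J. b' l choose b l)" for b' b
  have finB: "finite ?Box" using fin by (intro finite_PiE) auto
  have ch_pos: "b l \<le> b' l" if "ch b' b \<noteq> 0" "l \<in> J" for b b' l
    using that fin unfolding ch_def by (auto simp: not_less[symmetric])
  \<comment> \<open>Taylor expansion of the slice \<open>t = 0\<close> under the shift of every
    \<open>x l\<close> to \<open>x l - y\<close>.\<close>
  have g_eq: "g b t = (-1) ^ t * (\<Sum>b'\<in>?Box. of_nat (ch b' b) * g b' 0)"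
    if "b \<in> extensional J" "sum b J + t = D" for b t
    using that
  proof (induction t arbitrary: b)
    case 0
    have "of_nat (ch b' b) * g b' 0 = (if b' = b then g b 0 else 0)" if b': "b' \<in> ?Box" for b'
    proof (cases "ch b' b = 0 \<or> g b' 0 = 0")
      case True
      then show ?thesis using fin by (auto simp: ch_def)
    next
      case False
      have "b l = b' l" if "l \<in> J" for l
      proof (rule sum_mono_inv[of b J b'])
        show "sum b J = sum b' J" using False deg[of b' 0] 0 by simp
      qed (use that fin False ch_pos[of b' b] in blast)+
      then have "b' = b" using b' 0 by (intro extensionalityI[of _ J]) (auto simp: PiE_def)
      then show ?thesis by (simp add: ch_def)
    qed
    then have "(\<Sum>b'\<in>?Box. of_nat (ch b' b) * g b' 0) = (\<Sum>b'\<in>?Box. if b' = b then g b 0 else 0)"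
      by (intro sum.cong) auto
    also have "\<dots> = g b 0" using finB box[of b 0] by (auto simp: sum.delta)
    finally show ?case by simp
  next
    case (Suc t)
    have "of_nat (Suc t) * g b (Suc t) = - (\<Sum>l\<in>J. of_nat (Suc (b l)) * g (b(l := Suc (b l))) t)"
      using rel[OF Suc.prems(1), of t] by (simp add: add_eq_0_iff)
    also have "\<dots> = - (\<Sum>l\<in>J. of_nat (Suc (b l)) * ((-1) ^ t *
        (\<Sum>b'\<in>?Box. of_nat (ch b' (b(l := Suc (b l)))) * g b' 0)))"
    proof (intro arg_cong[where f = uminus] sum.cong refl arg_cong2[where f = "(*)"] Suc.IH)
      fix l assume l: "l \<in> J"
      show "b(l := Suc (b l)) \<in> extensional J"
        using Suc.prems(1) l by (auto simp: extensional_def)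
      have "sum (b(l := Suc (b l))) J = Suc (sum b J)"
        using fin l by (simp add: sum.remove[of J l])
      then show "sum (b(l := Suc (b l))) J + t = D"
        using Suc.prems(2) by simp
    qed
    also have "\<dots> = (-1) ^ Suc t * (\<Sum>b'\<in>?Box. (\<Sum>l\<in>J. of_nat (Suc (b l) * ch b' (b(l := Suc (b l)))) * g b' 0))"
      by (subst sum.swap) (simp add: sum_distrib_left mult_ac sum_negf del: of_nat_Suc mult_Suc mult_Suc_right)
    also have "(\<Sum>b'\<in>?Box. (\<Sum>l\<in>J. of_nat (Suc (b l) * ch b' (b(l := Suc (b l)))) * g b' 0)) =
        (\<Sum>b'\<in>?Box. of_nat (Suc t) * (of_nat (ch b' b) * g b' 0))"
    proof (intro sum.cong refl)
      fix b' assume b': "b' \<in> ?Box"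
      \<comment> \<open>Absorption in one coordinate. Summed over \<open>l\<close> it yields
        \<open>sum b' J - sum b J\<close>, which is \<open>Suc t\<close> wherever the summand is
        nonzero, and this factor cancels.\<close>
      have 1: "Suc (b l) * ch b' (b(l := Suc (b l))) = (b' l - b l) * ch b' b" if l: "l \<in> J" for l
      proof -
        have "Suc (b l) * (b' l choose Suc (b l)) = (b' l - b l) * (b' l choose b l)"
          using binomial_absorb_comp[of "b' l" "b l"] binomial_absorption[of "b l" "b' l"]
          by (cases "b' l") auto
        moreover have "(\<Prod>x\<in>J - {l}. b' x choose (b(l := Suc (b l))) x) = (\<Prod>x\<in>J - {l}. b' x choose b x)"
          by (intro prod.cong) auto
        ultimately show ?thesis
          unfolding ch_def prod.remove[OF fin l] by (simp only: mult.assoc[symmetric] fun_upd_same)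
      qed
      have "(\<Sum>l\<in>J. of_nat (Suc (b l) * ch b' (b(l := Suc (b l)))) * g b' 0) =
          of_nat ((\<Sum>l\<in>J. b' l - b l) * ch b' b) * g b' 0"
        by (simp only: of_nat_sum sum_distrib_right 1 cong: sum.cong)
      also have "\<dots> = of_nat (Suc t) * (of_nat (ch b' b) * g b' 0)"
      proof (cases "ch b' b = 0 \<or> g b' 0 = 0")
        case False
        have "(\<Sum>l\<in>J. b' l - b l) = sum b' J - sum b J"
          using ch_pos[of b' b] False by (intro sum_subtractf_nat) auto
        also have "\<dots> = Suc t" using deg[of b' 0] False Suc.prems by simp
        finally show ?thesis by (simp only: of_nat_mult mult.assoc)
      qed auto
      finally show "(\<Sum>l\<in>J. of_nat (Suc (b l) * ch b' (b(l := Suc (b l)))) * g b' 0) =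
          of_nat (Suc t) * (of_nat (ch b' b) * g b' 0)" .
    qed
    also have "(-1) ^ Suc t * (\<Sum>b'\<in>?Box. of_nat (Suc t) * (of_nat (ch b' b) * g b' 0)) =
        of_nat (Suc t) * ((-1) ^ Suc t * (\<Sum>b'\<in>?Box. of_nat (ch b' b) * g b' 0))"
      by (simp only: sum_distrib_left[symmetric] mult.left_commute)
    finally show ?case by (simp del: of_nat_Suc power_Suc)
  qed
  \<comment> \<open>A monomial of degree below \<open>sum b0 J\<close> needs a power of
    \<open>y\<close> above \<open>m\<close> to reach total degree \<open>D\<close>, so by
    \<open>top\<close> its coefficient is zero.\<close>
  have moment: "(\<Sum>b'\<in>?Box. of_nat (ch b' s) * g b' 0) = 0"
    if s: "s \<in> extensional J" "sum s J < sum b0 J" for s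
  proof -
    have D: "sum b0 J + m = D" using deg[OF nz] .
    have "g s (D - sum s J) = 0" using top[of s "D - sum s J"] s D by (cases "g s (D - sum s J) = 0") auto
    then show ?thesis using g_eq[of s "D - sum s J"] s D by simp
  qed
  \<comment> \<open>On the slice of the box of total degree \<open>D\<close>, the function
    \<open>b \<mapsto> \<Prod>l. (c l - b l) choose (c l - b1 l)\<close> is the indicator of \<open>b1\<close>, while as a
    polynomial in \<open>b\<close> it has degree at most \<open>sum c J - D\<close>.\<close>
  have h0: "g b1 0 = 0" for b1
  proof (rule ccontr)
    assume nz1: "g b1 0 \<noteq> 0"
    have b1: "b1 \<in> ?Box" "sum b1 J = D" using box[OF nz1] deg[OF nz1] by auto
    have "\<exists>a :: nat \<Rightarrow> 'a. \<forall>b\<le>c l. of_nat ((c l - b) choose (c l - b1 l)) =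
        (\<Sum>s\<le>c l - b1 l. a s * of_nat (b choose s))" for l
      by (rule choose_diff_expansion)
    then obtain a :: "'b \<Rightarrow> nat \<Rightarrow> 'a" where a: "\<And>l b. b \<le> c l \<Longrightarrow>
        of_nat ((c l - b) choose (c l - b1 l)) = (\<Sum>s\<le>c l - b1 l. a l s * of_nat (b choose s))"
      by metis
    let ?S = "\<Pi>\<^sub>E l\<in>J. {..c l - b1 l}"
    have "g b1 0 = (\<Sum>b\<in>?Box. if b = b1 then g b1 0 else 0)"
      using b1 finB by (simp add: sum.delta)
    also have "\<dots> = (\<Sum>b\<in>?Box. (\<Prod>l\<in>J. of_nat ((c l - b l) choose (c l - b1 l))) * g b 0)"
    proof (intro sum.cong refl)
      fix b assume b: "b \<in> ?Box"
      show "(if b = b1 then g b1 0 else 0) =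
          (\<Prod>l\<in>J. of_nat ((c l - b l) choose (c l - b1 l))) * g b 0"
      proof (cases "b = b1 \<or> g b 0 = 0")
        case False
        then have sb: "sum b J = sum b1 J" using deg[of b 0] b1 by auto
        have "\<exists>l\<in>J. b l > b1 l"
        proof (rule ccontr)
          assume "\<not> (\<exists>l\<in>J. b1 l < b l)"
          then have le: "\<And>l. l \<in> J \<Longrightarrow> b l \<le> b1 l" by (auto simp: not_less)
          have "b l = b1 l" if "l \<in> J" for l
            using sum_mono_inv[OF sb le that fin] by simp
          then have "b = b1" using b b1 by (intro extensionalityI[of _ J]) (auto simp: PiE_def)
          then show False using False by simp
        qed
        then obtain l where "l \<in> J" "b l > b1 l" by blast
        then have "(c l - b l) choose (c l - b1 l) = 0"
          using b by (intro binomial_eq_0) (auto simp: PiE_iff intro!: diff_less_mono2 intro: less_le_trans)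
        then have "(\<Prod>l\<in>J. of_nat ((c l - b l) choose (c l - b1 l)) :: 'a) = 0"
          using \<open>l \<in> J\<close> fin by (auto intro!: prod_zero)
        then show ?thesis using False by simp
      qed auto
    qed
    also have "\<dots> = (\<Sum>b\<in>?Box. (\<Sum>s\<in>?S. (\<Prod>l\<in>J. a l (s l)) * of_nat (ch b s)) * g b 0)"
    proof (intro sum.cong refl arg_cong2[where f = "(*)"])
      fix b assume b: "b \<in> ?Box"
      have "(\<Prod>l\<in>J. of_nat ((c l - b l) choose (c l - b1 l))) =
          (\<Prod>l\<in>J. \<Sum>s\<le>c l - b1 l. a l s * of_nat (b l choose s))"
        using b by (intro prod.cong refl a) auto
      also have "\<dots> = (\<Sum>s\<in>?S. \<Prod>l\<in>J. a l (s l) * of_nat (b l choose s l))"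
        using fin by (intro prod_sum_PiE) auto
      finally show "(\<Prod>l\<in>J. of_nat ((c l - b l) choose (c l - b1 l))) =
          (\<Sum>s\<in>?S. (\<Prod>l\<in>J. a l (s l)) * of_nat (ch b s))"
        by (simp add: ch_def prod.distrib)
    qed
    also have "\<dots> = (\<Sum>s\<in>?S. (\<Prod>l\<in>J. a l (s l)) * (\<Sum>b\<in>?Box. of_nat (ch b s) * g b 0))"
      by (simp add: sum_distrib_right sum_distrib_left sum.swap[of _ ?Box] mult.assoc)
    also have "\<dots> = 0"
    proof (rule sum.neutral, rule ballI)
      fix s assume s: "s \<in> ?S"
      have "sum s J \<le> (\<Sum>l\<in>J. c l - b1 l)" using s by (intro sum_mono) auto
      also have "\<dots> = sum c J - D"
        using b1 by (subst sum_subtractf_nat) auto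
      \<comment> \<open>The negated conclusion enters here: it puts the degree
        \<open>sum c J - D\<close> into the range covered by \<open>moment\<close>.\<close>
      also have "\<dots> < sum b0 J" using contr nz1 deg[OF nz] b1 sum_mono[of J b1 c] by fastforce
      finally have "(\<Sum>b\<in>?Box. of_nat (ch b s) * g b 0) = 0"
        using s by (intro moment) (auto simp: PiE_def)
      then show "(\<Prod>l\<in>J. a l (s l)) * (\<Sum>b\<in>?Box. of_nat (ch b s) * g b 0) = 0" by simp
    qed
    finally show False using nz1 by simp
  qed
  have "g b0 m = 0"
    using g_eq[of b0 m] box[OF nz] deg[OF nz] h0 by (simp add: PiE_def)
  then show False using nz by simp
qed

section \<open>Polynomials in the entries of a matrix\<close>

text \<open>Gaussian elimination: an unknown \<open>y\<close> occurring in the new equation serves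
  as pivot, and the system \<open>a'\<close> for the other unknowns has one equation and one unknown
  fewer.\<close>

lemma underdetermined_system_nontrivial_solution:
  fixes a :: "'e \<Rightarrow> 'm \<Rightarrow> 'a :: field"
  assumes "finite E" "finite M" "card E < card M"
  shows "\<exists>c. (\<exists>x\<in>M. c x \<noteq> 0) \<and> (\<forall>e\<in>E. (\<Sum>x\<in>M. c x * a e x) = 0)"
  using assms
proof (induction E arbitrary: M a rule: finite_induct)
  case empty
  then have "M \<noteq> {}" by auto
  then show ?case by (intro exI[of _ "\<lambda>_. 1"]) auto
next
  case (insert e E)
  show ?case
  proof (cases "\<forall>x\<in>M. a e x = 0")
    case True
    have "card E < card M" using insert by simp
    then obtain c where "\<exists>x\<in>M. c x \<noteq> 0" "\<forall>e\<in>E. (\<Sum>x\<in>M. c x * a e x) = 0"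
      using insert.IH[of M a] insert.prems by blast
    then show ?thesis using True by (intro exI[of _ c]) auto
  next
    case False
    then obtain y where y: "y \<in> M" "a e y \<noteq> 0" by blast
    define a' where "a' e' x = a e' x - a e x / a e y * a e' y" for e' x
    have "card E < card (M - {y})" using insert y by simp
    then obtain c where c: "\<exists>x\<in>M - {y}. c x \<noteq> 0" "\<forall>e\<in>E. (\<Sum>x\<in>M - {y}. c x * a' e x) = 0"
      using insert.IH[of "M - {y}" a'] insert.prems by blast
    define s where "s = (\<Sum>x\<in>M - {y}. c x * a e x)"
    define c' where "c' = c(y := - s / a e y)"
    have sum_c': "(\<Sum>x\<in>M. c' x * a e' x) = (\<Sum>x\<in>M - {y}. c x * a e' x) - s / a e y * a e' y" for e'
    proof -
      have "(\<Sum>x\<in>M. c' x * a e' x) = c' y * a e' y + (\<Sum>x\<in>M - {y}. c' x * a e' x)"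
        using insert.prems y by (intro sum.remove) auto
      also have "(\<Sum>x\<in>M - {y}. c' x * a e' x) = (\<Sum>x\<in>M - {y}. c x * a e' x)"
        by (intro sum.cong) (auto simp: c'_def)
      finally show ?thesis by (simp add: c'_def)
    qed
    have "(\<Sum>x\<in>M. c' x * a e x) = 0"
      using y by (simp add: sum_c' s_def[symmetric])
    moreover have "(\<Sum>x\<in>M. c' x * a e' x) = 0" if "e' \<in> E" for e'
    proof -
      have "(\<Sum>x\<in>M. c' x * a e' x) = (\<Sum>x\<in>M - {y}. c x * a' e' x)"
        unfolding sum_c' a'_def s_def
        by (simp add: sum_divide_distrib sum_distrib_left sum_subtractf right_diff_distrib mult_ac)
      then show ?thesis using c that by simp
    qed
    moreover have "\<exists>x\<in>M. c' x \<noteq> 0" using c by (auto simp: c'_def)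
    ultimately show ?thesis by (intro exI[of _ c']) auto
  qed
qed

section \<open>Power products and comparison of coefficients\<close>

definition power_prod :: "'a set \<Rightarrow> ('a \<Rightarrow> nat) \<Rightarrow> ('a \<Rightarrow> 'b) \<Rightarrow> 'b :: comm_monoid_mult" where
  "power_prod I A u = (\<Prod>x\<in>I. u x ^ A x)"

lemma power_prod_add: "power_prod I (\<lambda>x. A x + B x) u = power_prod I A u * (power_prod I B u :: 'b :: comm_monoid_mult)"
  by (simp add: power_prod_def power_add prod.distrib)

text \<open>With all variables but \<open>x\<close> fixed, the sum is a univariate polynomial
  vanishing everywhere on an infinite domain, hence zero. Its coefficient at \<open>A0 x\<close> is
  a relation in one variable fewer.\<close>

lemma power_prod_linear_independent:
  fixes c :: "('a \<Rightarrow> nat) \<Rightarrow> 'b :: {idom, ring_char_0}"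
  assumes "finite I" "finite \<A>"
    and "\<And>A B. A \<in> \<A> \<Longrightarrow> B \<in> \<A> \<Longrightarrow> (\<And>x. x \<in> I \<Longrightarrow> A x = B x) \<Longrightarrow> A = B"
    and "\<And>u. (\<Sum>A\<in>\<A>. c A * power_prod I A u) = 0"
    and "A0 \<in> \<A>"
  shows "c A0 = 0"
  using assms
proof (induction I arbitrary: \<A> A0 rule: finite_induct)
  case empty
  then have "\<A> = {A0}" by auto
  then show ?case using empty.prems(3)[of undefined] by (simp add: power_prod_def)
next
  case (insert x I)
  let ?A = "{A \<in> \<A>. A x = A0 x}"
  have "(\<Sum>A\<in>?A. c A * power_prod I A u) = 0" for u
  proof -
    define p where "p = (\<Sum>A\<in>\<A>. monom (c A * power_prod I A u) (A x))"
    have "poly p t = 0" for t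
    proof -
      have "power_prod (insert x I) A (u(x := t)) = t ^ A x * power_prod I A u" for A
      proof -
        have "(\<Prod>y\<in>I. (u(x := t)) y ^ A y) = (\<Prod>y\<in>I. u y ^ A y)"
          using insert.hyps by (intro prod.cong) auto
        then show ?thesis using insert.hyps by (simp add: power_prod_def)
      qed
      then have "poly p t = (\<Sum>A\<in>\<A>. c A * power_prod (insert x I) A (u(x := t)))"
        by (simp add: p_def poly_sum poly_monom mult_ac)
      then show ?thesis using insert.prems by simp
    qed
    then have "p = 0" using poly_all_0_iff_0 by blast
    then have "0 = coeff p (A0 x)" by simp
    also have "\<dots> = (\<Sum>A\<in>\<A>. if A x = A0 x then c A * power_prod I A u else 0)"
      by (simp add: p_def coeff_sum)
    also have "\<dots> = (\<Sum>A\<in>?A. c A * power_prod I A u)"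
      using insert.prems by (simp add: sum.inter_filter)
    finally show ?thesis by simp
  qed
  moreover have "finite ?A" "A0 \<in> ?A" using insert.prems by auto
  moreover have "A = B" if "A \<in> ?A" "B \<in> ?A" "\<And>y. y \<in> I \<Longrightarrow> A y = B y" for A B
    using that by (intro insert.prems(2)) auto
  ultimately show ?case using insert.IH[of ?A A0] by blast
qed

text \<open>Form of independence for families in which several indices share an exponent: equal
  exponents are grouped first. The support condition upgrades agreement on \<open>I\<close> to
  equality.\<close>

lemma power_prod_family_coeff_zero:
  fixes c :: "'p \<Rightarrow> 'b :: {idom, ring_char_0}"
  assumes "finite I" "finite P"
    and supp: "\<And>p x. p \<in> P \<Longrightarrow> x \<notin> I \<Longrightarrow> m p x = (0::nat)"
    and zero: "\<And>u. (\<Sum>p\<in>P. c p * power_prod I (m p) u) = 0"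
  shows "(\<Sum>p | p \<in> P \<and> m p = B. c p) = 0"
proof (cases "B \<in> m ` P")
  case True
  show ?thesis
  proof (rule power_prod_linear_independent[of I "m ` P"])
    show "(\<Sum>A\<in>m ` P. (\<Sum>p | p \<in> P \<and> m p = A. c p) * power_prod I A u) = 0" for u
    proof -
      have "(\<Sum>A\<in>m ` P. (\<Sum>p | p \<in> P \<and> m p = A. c p) * power_prod I A u) =
          (\<Sum>A\<in>m ` P. \<Sum>p | p \<in> P \<and> m p = A. c p * power_prod I (m p) u)"
        by (simp add: sum_distrib_right)
      also have "\<dots> = 0"
        using zero[of u] sum.image_gen[OF assms(2), of "\<lambda>p. c p * power_prod I (m p) u" m] by simp
      finally show ?thesis .
    qed
    show "A = B" if AB: "A \<in> m ` P" "B \<in> m ` P" "\<And>x. x \<in> I \<Longrightarrow> A x = B x" for A B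
    proof
      fix x show "A x = B x" using AB supp by (cases "x \<in> I") fastforce+
    qed
  qed (use assms True in auto)
next
  case False
  then have "{p. p \<in> P \<and> m p = B} = {}" by auto
  then show ?thesis by (simp only: sum.empty)
qed

section \<open>Exponent matrices and row operations\<close>

definition grid :: "nat \<Rightarrow> nat \<Rightarrow> (nat \<times> nat) set" where
  "grid d N = {..<d} \<times> {..<N}"

text \<open>A product of \<open>k\<close> maximal minors has degree \<open>k\<close> in each row
  separately, so only these exponents occur in it.\<close>

definition exps :: "nat \<Rightarrow> nat \<Rightarrow> nat \<Rightarrow> (nat \<times> nat \<Rightarrow> nat) set" where
  "exps d N k = {A. (\<forall>x. x \<notin> grid d N \<longrightarrow> A x = 0) \<and> (\<forall>i<d. (\<Sum>l<N. A (i, l)) = k)}"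

lemma finite_grid [simp]: "finite (grid d N)"
  by (simp add: grid_def)

lemma exps_le: "A \<in> exps d N k \<Longrightarrow> A x \<le> k"
proof (cases "x \<in> grid d N")
  case True
  assume A: "A \<in> exps d N k"
  obtain i l where x: "x = (i, l)" "i < d" "l < N" using True by (auto simp: grid_def)
  have "A (i, l) \<le> (\<Sum>l<N. A (i, l))" using x by (intro member_le_sum) auto
  then show "A x \<le> k" using A x by (simp add: exps_def)
next
  case False
  assume "A \<in> exps d N k"
  then have "A x = 0" using False unfolding exps_def by blast
  then show "A x \<le> k" by simp
qed

lemma finite_exps [simp]: "finite (exps d N k)"
proof (rule finite_subset)
  show "exps d N k \<subseteq> {A. \<forall>x. (x \<in> grid d N \<longrightarrow> A x \<in> {..k}) \<and> (x \<notin> grid d N \<longrightarrow> A x = 0)}"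
    using exps_le by (auto simp: exps_def)
  show "finite {A. \<forall>x. (x \<in> grid d N \<longrightarrow> A x \<in> {..k}) \<and> (x \<notin> grid d N \<longrightarrow> A x = (0::nat))}"
    by (rule finite_set_of_finite_funs) auto
qed

definition add_row :: "nat \<Rightarrow> nat \<Rightarrow> complex \<Rightarrow> (nat \<times> nat \<Rightarrow> complex) \<Rightarrow> nat \<times> nat \<Rightarrow> complex" where
  "add_row r s w u = (\<lambda>x. u x + w * (if fst x = r then u (s, snd x) else 0))"

text \<open>The effect of \<open>x (r, l) \<partial>/\<partial>x (Suc r, l)\<close> on an exponent;
  \<open>drop_box\<close> reverses it when \<open>A (Suc r, l)\<close> is positive.\<close>

abbreviation lift_box :: "nat \<Rightarrow> nat \<Rightarrow> (nat \<times> nat \<Rightarrow> nat) \<Rightarrow> nat \<times> nat \<Rightarrow> nat" where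
  "lift_box r l A \<equiv> A((r, l) := Suc (A (r, l)), (Suc r, l) := A (Suc r, l) - 1)"

abbreviation drop_box :: "nat \<Rightarrow> nat \<Rightarrow> (nat \<times> nat \<Rightarrow> nat) \<Rightarrow> nat \<times> nat \<Rightarrow> nat" where
  "drop_box r l B \<equiv> B((r, l) := B (r, l) - 1, (Suc r, l) := Suc (B (Suc r, l)))"

text \<open>Only factors in row \<open>Suc r\<close> depend on \<open>w\<close>; the product rule
  brings down an exponent there and trades one \<open>u (Suc r, l)\<close> for
  \<open>u (r, l)\<close>.\<close>

lemma power_prod_add_row_has_derivative:
  assumes r: "Suc r < d"
  shows "((\<lambda>w. power_prod (grid d N) A (add_row (Suc r) r w u)) has_field_derivative
     (\<Sum>l<N. of_nat (A (Suc r, l)) * power_prod (grid d N) (lift_box r l A) u)) (at 0)"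
proof -
  let ?G = "grid d N"
  let ?q = "\<lambda>x. if fst x = Suc r then u (r, snd x) else 0"
  let ?f' = "\<lambda>x. of_nat (A x) * u x ^ (A x - 1) * ?q x"
  have "((\<lambda>w. \<Prod>x\<in>?G. add_row (Suc r) r w u x ^ A x) has_field_derivative
      (\<Sum>x\<in>?G. ?f' x * (\<Prod>y\<in>?G - {x}. add_row (Suc r) r 0 u y ^ A y))) (at 0)"
    by (rule has_field_derivative_prod)
      (auto simp: add_row_def intro!: derivative_eq_intros)
  also have "(\<Sum>x\<in>?G. ?f' x * (\<Prod>y\<in>?G - {x}. add_row (Suc r) r 0 u y ^ A y)) =
      (\<Sum>x\<in>?G. ?f' x * (\<Prod>y\<in>?G - {x}. u y ^ A y))"
    by (simp add: add_row_def)
  also have "\<dots> = (\<Sum>x\<in>Pair (Suc r) ` {..<N}. ?f' x * (\<Prod>y\<in>?G - {x}. u y ^ A y))"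
    using r by (intro sum.mono_neutral_right) (auto simp: grid_def)
  also have "\<dots> = (\<Sum>l<N. ?f' (Suc r, l) * (\<Prod>y\<in>?G - {(Suc r, l)}. u y ^ A y))"
    by (subst sum.reindex) (auto simp: inj_on_def)
  also have "\<dots> = (\<Sum>l<N. of_nat (A (Suc r, l)) * power_prod ?G (lift_box r l A) u)"
  proof (intro sum.cong refl)
    fix l assume l: "l \<in> {..<N}"
    let ?x = "(Suc r, l)" and ?y = "(r, l)"
    have x: "?x \<in> ?G" and y: "?y \<in> ?G - {?x}" using l r by (auto simp: grid_def)
    have "power_prod ?G (lift_box r l A) u =
        u ?x ^ (A ?x - 1) * (u ?y ^ Suc (A ?y) * (\<Prod>z\<in>?G - {?x} - {?y}. u z ^ lift_box r l A z))"
      unfolding power_prod_def using x y by (simp add: prod.remove[of _ ?x] prod.remove[of _ ?y])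
    also have "(\<Prod>z\<in>?G - {?x} - {?y}. u z ^ lift_box r l A z) = (\<Prod>z\<in>?G - {?x} - {?y}. u z ^ A z)"
      by (intro prod.cong) auto
    finally show "?f' ?x * (\<Prod>y\<in>?G - {?x}. u y ^ A y) =
        of_nat (A ?x) * power_prod ?G (lift_box r l A) u"
      using y by (simp only: prod.remove[of "?G - {?x}" ?y] finite_Diff finite_grid fst_conv snd_conv
          if_True simp_thms power_Suc mult_ac)
  qed
  finally show ?thesis unfolding power_prod_def .
qed

text \<open>By invariance the derivative at \<open>w = 0\<close> vanishes; the relation is its
  coefficient at the monomial \<open>B\<close>.\<close>

lemma row_invariant_coeff_relation:
  assumes r: "Suc r < d"
    and inv: "\<And>u w. F (add_row (Suc r) r w u) = F u"
    and F: "\<And>u. F u = (\<Sum>A\<in>exps d N k. g A * power_prod (grid d N) A u)"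
    and g: "\<And>A. A \<notin> exps d N k \<Longrightarrow> g A = 0"
  shows "(\<Sum>l | l < N \<and> B (r, l) > 0. of_nat (Suc (B (Suc r, l))) * g (drop_box r l B)) = 0"
proof -
  let ?G = "grid d N" and ?X = "exps d N k"
  \<comment> \<open>Pairs with \<open>A (Suc r, l) = 0\<close> contribute nothing; leaving them out
    avoids truncated subtraction, so that \<open>drop_box\<close> inverts
    \<open>lift_box\<close>.\<close>
  define P where "P = {(A, l). A \<in> ?X \<and> l < N \<and> A (Suc r, l) > 0}"
  have P: "P \<subseteq> ?X \<times> {..<N}" by (auto simp: P_def)
  then have finP: "finite P" by (rule finite_subset) simp
  have "(\<Sum>p\<in>P. (g (fst p) * of_nat (fst p (Suc r, snd p))) * power_prod ?G (lift_box r (snd p) (fst p)) u) = 0" for u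
  proof -
    have "((\<lambda>w. \<Sum>A\<in>?X. g A * power_prod ?G A (add_row (Suc r) r w u)) has_field_derivative
        (\<Sum>A\<in>?X. g A * (\<Sum>l<N. of_nat (A (Suc r, l)) * power_prod ?G (lift_box r l A) u))) (at 0)"
      by (intro DERIV_sum DERIV_cmult power_prod_add_row_has_derivative r)
    then have "((\<lambda>w. F u) has_field_derivative
        (\<Sum>A\<in>?X. g A * (\<Sum>l<N. of_nat (A (Suc r, l)) * power_prod ?G (lift_box r l A) u))) (at 0)"
      by (simp only: F[symmetric] inv)
    then have "0 = (\<Sum>A\<in>?X. g A * (\<Sum>l<N. of_nat (A (Suc r, l)) * power_prod ?G (lift_box r l A) u))"
      by (rule DERIV_unique[OF DERIV_const])
    also have "\<dots> = (\<Sum>(A, l)\<in>?X \<times> {..<N}. (g A * of_nat (A (Suc r, l))) * power_prod ?G (lift_box r l A) u)"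
      by (simp add: sum.cartesian_product[symmetric] sum_distrib_left mult.assoc)
    also have "\<dots> = (\<Sum>(A, l)\<in>P. (g A * of_nat (A (Suc r, l))) * power_prod ?G (lift_box r l A) u)"
      using P by (intro sum.mono_neutral_right) (auto simp: P_def)
    finally show ?thesis by (simp add: case_prod_unfold)
  qed
  then have "(\<Sum>p | p \<in> P \<and> lift_box r (snd p) (fst p) = B. g (fst p) * of_nat (fst p (Suc r, snd p))) = 0"
    using r finP by (intro power_prod_family_coeff_zero[of ?G P]) (auto simp: P_def exps_def grid_def)
  also have "(\<Sum>p | p \<in> P \<and> lift_box r (snd p) (fst p) = B. g (fst p) * of_nat (fst p (Suc r, snd p))) =
      (\<Sum>l | l < N \<and> B (r, l) > 0 \<and> drop_box r l B \<in> ?X. of_nat (Suc (B (Suc r, l))) * g (drop_box r l B))"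
  proof (rule sum.reindex_bij_witness[where i = "\<lambda>l. (drop_box r l B, l)" and j = snd])
    fix p assume "p \<in> {p. p \<in> P \<and> lift_box r (snd p) (fst p) = B}"
    then obtain A l where p: "p = (A, l)" "A \<in> ?X" "l < N" "A (Suc r, l) > 0" "B = lift_box r l A"
      by (cases p) (auto simp: P_def)
    have A: "drop_box r l B = A" using p(4) by (auto simp: p(5))
    then show "(drop_box r (snd p) B, snd p) = p"
      "snd p \<in> {l. l < N \<and> 0 < B (r, l) \<and> drop_box r l B \<in> ?X}"
      using p by (simp_all only: p(1) snd_conv) (auto simp: p(5))
    show "of_nat (Suc (B (Suc r, snd p))) * g (drop_box r (snd p) B) = g (fst p) * of_nat (fst p (Suc r, snd p))"
      using p(4) by (simp only: p(1) snd_conv fst_conv A) (simp add: p(5))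
  next
    fix l assume l: "l \<in> {l. l < N \<and> 0 < B (r, l) \<and> drop_box r l B \<in> ?X}"
    then show "snd (drop_box r l B, l) = l"
      "(drop_box r l B, l) \<in> {p. p \<in> P \<and> lift_box r (snd p) (fst p) = B}"
      by (auto simp: P_def fun_eq_iff)
  qed
  \<comment> \<open>Indices with \<open>drop_box r l B\<close> outside \<open>exps d N k\<close> may
    be added, since \<open>g\<close> is zero there.\<close>
  also have "\<dots> = (\<Sum>l | l < N \<and> B (r, l) > 0. of_nat (Suc (B (Suc r, l))) * g (drop_box r l B))"
    using g by (intro sum.mono_neutral_left) auto
  finally show ?thesis .
qed

section \<open>Leading exponents of row-invariant polynomials\<close>

text \<open>If row \<open>i\<close> of a tableau lists \<open>A (i, l)\<close> copies of each
  \<open>l\<close> in increasing order, this is strictness of columns: the entries of row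
  \<open>Suc r\<close> that are at most \<open>j\<close> all sit under entries smaller than
  \<open>j\<close>.\<close>

definition ballot :: "nat \<Rightarrow> nat \<Rightarrow> (nat \<times> nat \<Rightarrow> nat) \<Rightarrow> bool" where
  "ballot d N A \<longleftrightarrow>
     (\<forall>r j. Suc r < d \<longrightarrow> j < N \<longrightarrow> (\<Sum>l\<le>j. A (Suc r, l)) \<le> (\<Sum>l<j. A (r, l)))"

text \<open>The weight \<open>i * K ^ l\<close> compares exponents that differ in two adjacent rows and have equal
  column sums lexicographically from the last column, provided all entries are below \<open>K\<close>.\<close>

definition wt :: "nat \<Rightarrow> nat \<Rightarrow> nat \<Rightarrow> (nat \<times> nat \<Rightarrow> nat) \<Rightarrow> nat" where
  "wt d N K A = (\<Sum>l<N. K ^ l * (\<Sum>i<d. i * A (i, l)))"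

text \<open>The highest differing digit decides: below position \<open>m\<close> the digits of
  \<open>a\<close> contribute less than \<open>K ^ m\<close>, which the surplus of
  \<open>b m\<close> covers.\<close>

lemma digit_sum_less:
  fixes a b :: "nat \<Rightarrow> nat"
  assumes "\<And>l. l < N \<Longrightarrow> a l < K" "m < N" "\<And>l. m < l \<Longrightarrow> l < N \<Longrightarrow> a l = b l" "a m < b m"
  shows "(\<Sum>l<N. K ^ l * a l) < (\<Sum>l<N. K ^ l * b l)"
  using assms
proof (induction N)
  case (Suc N)
  show ?case
  proof (cases "m = N")
    case True
    have "(\<Sum>l<n. K ^ l * a l) < K ^ n" if "n \<le> N" for n
      using that
    proof (induction n)
      case (Suc n)
      have "(\<Sum>l<Suc n. K ^ l * a l) < K ^ n + K ^ n * a n" using Suc by simp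
      also have "\<dots> = K ^ n * Suc (a n)" by simp
      also have "\<dots> \<le> K ^ n * K" using Suc.prems \<open>\<And>l. l < Suc N \<Longrightarrow> a l < K\<close>
        by (intro mult_left_mono) (auto simp: Suc_le_eq)
      finally show ?case by (simp add: mult.commute)
    qed simp
    then have "(\<Sum>l<Suc N. K ^ l * a l) < K ^ N * Suc (a N)" by (simp add: add.commute)
    also have "\<dots> \<le> K ^ N * b N" using Suc.prems True by (intro mult_left_mono) auto
    also have "\<dots> \<le> (\<Sum>l<Suc N. K ^ l * b l)" by simp
    finally show ?thesis .
  next
    case False
    then show ?thesis using Suc by (auto simp: less_Suc_eq)
  qed
qed simp

text \<open>With column sums fixed, rows \<open>r\<close> and \<open>Suc r\<close> contribute
  \<open>r\<close> times the column sum plus the entry in row \<open>Suc r\<close>, so the weights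
  differ exactly as the base \<open>Suc k\<close> numbers with the digits of that row.\<close>

lemma wt_less:
  assumes A: "A \<in> exps d N k" and r: "Suc r < d" and m: "m < N"
    and other: "\<And>i l. i \<noteq> r \<Longrightarrow> i \<noteq> Suc r \<Longrightarrow> B (i, l) = A (i, l)"
    and col: "\<And>l. B (r, l) + B (Suc r, l) = A (r, l) + A (Suc r, l)"
    and above: "\<And>l. m < l \<Longrightarrow> l < N \<Longrightarrow> B (Suc r, l) = A (Suc r, l)"
    and less: "A (Suc r, m) < B (Suc r, m)"
  shows "wt d N (Suc k) A < wt d N (Suc k) B"
proof -
  have split: "(\<Sum>i<d. i * X (i, l)) =
      r * (X (r, l) + X (Suc r, l)) + X (Suc r, l) + (\<Sum>i\<in>{..<d} - {r} - {Suc r}. i * X (i, l))"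
    for X :: "nat \<times> nat \<Rightarrow> nat" and l
    using r by (simp add: sum.remove[of "{..<d}" r] sum.remove[of "{..<d} - {r}" "Suc r"] algebra_simps)
  have "(\<Sum>i<d. i * B (i, l)) + A (Suc r, l) = (\<Sum>i<d. i * A (i, l)) + B (Suc r, l)" for l
    unfolding split col using other by simp
  then have "wt d N (Suc k) B + (\<Sum>l<N. Suc k ^ l * A (Suc r, l)) =
      wt d N (Suc k) A + (\<Sum>l<N. Suc k ^ l * B (Suc r, l))"
    unfolding wt_def sum.distrib[symmetric] distrib_left[symmetric] by simp
  moreover have "(\<Sum>l<N. Suc k ^ l * A (Suc r, l)) < (\<Sum>l<N. Suc k ^ l * B (Suc r, l))"
    using m less above exps_le[OF A] by (intro digit_sum_less[of _ _ _ m]) (auto simp: less_Suc_eq_le)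
  ultimately show ?thesis by linarith
qed

text \<open>For fixed \<open>r\<close> and \<open>j\<close>, vary only columns up to
  \<open>j\<close> of rows \<open>r\<close> and \<open>Suc r\<close>, keeping column sums.
  Maximality of the weight bounds the entry in column \<open>j\<close> and removes the later columns
  from \<open>rel\<close>; what remains is the situation of \<open>lefschetz_bound\<close>, whose
  inequality is the ballot condition after cancelling row \<open>Suc r\<close>.\<close>

lemma ballot_of_max_weight:
  assumes A: "A \<in> exps d N k" and gA: "g A \<noteq> (0 :: complex)"
    and supp: "\<And>B. g B \<noteq> 0 \<Longrightarrow> B \<in> exps d N k"
    and rel: "\<And>r B. Suc r < d \<Longrightarrow>
      (\<Sum>l | l < N \<and> B (r, l) > 0. of_nat (Suc (B (Suc r, l))) * g (drop_box r l B)) = 0"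
    and max: "\<And>B. g B \<noteq> 0 \<Longrightarrow> wt d N (Suc k) B \<le> wt d N (Suc k) A"
  shows "ballot d N A"
  unfolding ballot_def
proof (intro allI impI)
  fix r j assume r: "Suc r < d" and j: "j < N"
  \<comment> \<open>The operator moves boxes within a column, so these sums are conserved. In
    \<open>E b t\<close>, row \<open>Suc r\<close> has entries \<open>b\<close> before column
    \<open>j\<close>, \<open>t\<close> at \<open>j\<close> and those of \<open>A\<close> afterwards;
    row \<open>r\<close> is the complement in \<open>cs\<close>.\<close>
  define cs where "cs l = A (r, l) + A (Suc r, l)" for l
  define row where "row b t l = (if l < j then b l else if l = j then t else A (Suc r, l))"
    for b :: "nat \<Rightarrow> nat" and t l
  define E where "E b t = (\<lambda>(i, l). if i = Suc r then row b t l
      else if i = r then cs l - row b t l else A (i, l))" for b t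
  \<comment> \<open>This guard keeps the difference \<open>cs l - row b t l\<close> from being
    truncated.\<close>
  define ok where "ok b t \<longleftrightarrow> b \<in> (\<Pi>\<^sub>E l\<in>{..<j}. {..cs l}) \<and> t \<le> cs j" for b t
  define h where "h b t = (if ok b t then g (E b t) else 0)" for b t
  define b0 where "b0 = restrict (\<lambda>l. A (Suc r, l)) {..<j}"
  have row_le: "row b t l \<le> cs l" if "ok b t" for b t l
    using that by (auto simp: row_def ok_def cs_def)
  have ok_le: "b l \<le> cs l" if "ok b t" "l < j" for b t l
    using that by (auto simp: ok_def)
  have colE: "E b t (r, l) + E b t (Suc r, l) = cs l" if "ok b t" for b t l
    using row_le[OF that] by (simp add: E_def)
  have split: "(\<Sum>l<N. f l) = (\<Sum>l<j. f l) + f j + (\<Sum>l\<in>{j<..<N}. f l)" for f :: "nat \<Rightarrow> nat"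
  proof -
    have "{..<N} = {..<j} \<union> ({j} \<union> {j<..<N})" using j by auto
    then show ?thesis by (simp add: sum.union_disjoint disjoint_iff)
  qed
  have E0: "E b0 (A (Suc r, j)) = A"
    by (auto simp: E_def row_def b0_def cs_def fun_eq_iff)
  have ok0: "ok b0 (A (Suc r, j))" by (auto simp: ok_def b0_def cs_def)
  \<comment> \<open>Such a \<open>B\<close> exceeds \<open>A\<close> at the last column where their
    rows \<open>Suc r\<close> differ, so it would outweigh \<open>A\<close>.\<close>
  have zero: "g B = 0" if "\<And>i l. i \<noteq> r \<Longrightarrow> i \<noteq> Suc r \<Longrightarrow> B (i, l) = A (i, l)"
    "\<And>l. B (r, l) + B (Suc r, l) = cs l" "m < N"
    "\<And>l. m < l \<Longrightarrow> B (Suc r, l) = A (Suc r, l)" "A (Suc r, m) < B (Suc r, m)" for B m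
    using wt_less[OF A r, of m B] that max[of B] by (force simp: cs_def)
  have "(\<Sum>l\<le>j. A (Suc r, l)) + sum b0 {..<j} \<le> sum cs {..<j}"
  proof (rule lefschetz_bound[where g = h and m = "A (Suc r, j)"])
    show "h b0 (A (Suc r, j)) \<noteq> 0" using E0 ok0 gA by (simp add: h_def)
    show "b \<in> (\<Pi>\<^sub>E l\<in>{..<j}. {..cs l})" if "h b t \<noteq> 0" for b t
      using that by (auto simp: h_def ok_def split: if_splits)
    show "sum b {..<j} + t = (\<Sum>l\<le>j. A (Suc r, l))" if "h b t \<noteq> 0" for b t
    proof -
      have "g (E b t) \<noteq> 0" using that by (auto simp: h_def split: if_splits)
      then have "(\<Sum>l<N. E b t (Suc r, l)) = k" using supp r by (auto simp: exps_def)
      moreover have "(\<Sum>l<N. A (Suc r, l)) = k" using A r by (auto simp: exps_def)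
      ultimately have "(\<Sum>l<N. row b t l) = (\<Sum>l<N. A (Suc r, l))" by (simp add: E_def)
      then show ?thesis
        unfolding split by (simp add: row_def atMost_Suc lessThan_Suc_atMost[symmetric])
    qed
    \<comment> \<open>Columns after \<open>j\<close> agree with \<open>A\<close>, so a larger
      \<open>t\<close> would contradict maximality.\<close>
    show "t \<le> A (Suc r, j)" if "h b t \<noteq> 0" for b t
    proof (rule ccontr)
      assume "\<not> t \<le> A (Suc r, j)"
      moreover have "ok b t" using that by (simp add: h_def split: if_splits)
      ultimately have "g (E b t) = 0" using j
        by (intro zero[of _ j] colE) (simp_all add: E_def row_def)
      then show False using that by (simp add: h_def split: if_splits)
    qed
    show "of_nat (Suc t) * h b (Suc t) +
        (\<Sum>l<j. of_nat (Suc (b l)) * h (b(l := Suc (b l))) t) = 0" if b: "b \<in> extensional {..<j}" for b t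
    proof (cases "ok b t")
      case False
      have "\<not> ok b (Suc t)" using False Suc_leD unfolding ok_def by blast
      moreover have "\<not> ok (b(l := Suc (b l))) t" for l
      proof
        assume ok': "ok (b(l := Suc (b l))) t"
        have "b i \<le> cs i" if "i < j" for i
          using ok_le[OF ok' that] by (simp split: if_splits)
        then have "ok b t" using b ok' by (simp add: ok_def PiE_iff)
        then show False using False by simp
      qed
      ultimately show ?thesis by (simp add: h_def)
    next
      case ok: True
      let ?B = "E b t"
      \<comment> \<open>The summands of \<open>rel\<close> at \<open>E b t\<close>: columns before
        \<open>j\<close> give the sum over \<open>b\<close>, column \<open>j\<close> gives the term
        in \<open>Suc t\<close>, and later columns vanish because a box dropped there makes the
        exponent heavier than \<open>A\<close>.\<close>
      define T where "T l = (if ?B (r, l) > 0 then of_nat (Suc (?B (Suc r, l))) * g (drop_box r l ?B) else 0)" for l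
      have T1: "T l = of_nat (Suc (b l)) * h (b(l := Suc (b l))) t" if l: "l < j" for l
      proof (cases "b l < cs l")
        case True
        have "drop_box r l ?B = E (b(l := Suc (b l))) t"
          using l by (auto simp: E_def row_def fun_eq_iff)
        moreover have "ok (b(l := Suc (b l))) t" using ok True l by (auto simp: ok_def PiE_iff extensional_def)
        ultimately show ?thesis using True l by (simp add: T_def h_def E_def row_def)
      next
        case False
        then have "\<not> ok (b(l := Suc (b l))) t" using l by (auto simp: ok_def PiE_iff)
        then show ?thesis using False l by (simp add: T_def h_def E_def row_def)
      qed
      have T2: "T j = of_nat (Suc t) * h b (Suc t)"
      proof (cases "t < cs j")
        case True
        have "drop_box r j ?B = E b (Suc t)"
          by (auto simp: E_def row_def fun_eq_iff)
        moreover have "ok b (Suc t)" using ok True by (auto simp: ok_def)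
        ultimately show ?thesis using True by (simp add: T_def h_def E_def row_def)
      next
        case False
        then have "\<not> ok b (Suc t)" by (auto simp: ok_def)
        then show ?thesis using False by (simp add: T_def h_def E_def row_def)
      qed
      have T3: "T l = 0" if l: "j < l" "l < N" for l
      proof (cases "?B (r, l) > 0")
        case True
        have "g (drop_box r l ?B) = 0"
        proof (rule zero[of _ l])
          show "drop_box r l ?B (r, l') + drop_box r l ?B (Suc r, l') = cs l'" for l'
            using colE[OF ok, of l'] True by auto
        qed (use l in \<open>auto simp: E_def row_def\<close>)
        then show ?thesis by (simp add: T_def)
      qed (simp add: T_def)
      have "0 = (\<Sum>l<N. T l)"
        using rel[OF r, of ?B] by (simp add: T_def sum.inter_filter[symmetric] lessThan_def conj_commute)
      also have "\<dots> = (\<Sum>l\<in>insert j {..<j}. T l)"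
        using j T3 by (intro sum.mono_neutral_right) auto
      also have "\<dots> = of_nat (Suc t) * h b (Suc t) +
          (\<Sum>l<j. of_nat (Suc (b l)) * h (b(l := Suc (b l))) t)"
        using T1 T2 by simp
      finally show ?thesis by simp
    qed
  qed simp
  then show "(\<Sum>l\<le>j. A (Suc r, l)) \<le> (\<Sum>l<j. A (r, l))"
    by (simp add: b0_def cs_def sum.distrib)
qed

section \<open>Upper bound for the dimension\<close>

definition minor :: "nat \<Rightarrow> (nat \<times> nat \<Rightarrow> complex) \<Rightarrow> nat set \<Rightarrow> complex" where
  "minor d u S = plucker_coord d (\<lambda>i l. u (i, l)) S"

definition minor_product :: "nat \<Rightarrow> nat \<Rightarrow> (nat set \<Rightarrow> nat) \<Rightarrow> (nat \<times> nat \<Rightarrow> complex) \<Rightarrow> complex" where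
  "minor_product d N \<alpha> u = (\<Prod>S\<in>plucker_index d N. minor d u S ^ \<alpha> S)"

lemma finite_plucker_index [simp]: "finite (plucker_index d N)"
  by (rule finite_subset[of _ "Pow {0..<N}"]) (auto simp: plucker_index_def)

lemma sorted_list_plucker_index:
  assumes "S \<in> plucker_index d N"
  shows "length (sorted_list_of_set S) = d" "i < d \<Longrightarrow> sorted_list_of_set S ! i < N"
proof -
  have S: "S \<subseteq> {0..<N}" "card S = d" using assms by (auto simp: plucker_index_def)
  then have fin: "finite S" by (auto intro: finite_subset)
  show len: "length (sorted_list_of_set S) = d" using S fin by simp
  show "sorted_list_of_set S ! i < N" if "i < d"
    using that len S fin nth_mem[of i "sorted_list_of_set S"] by auto
qed

text \<open>The cone is the image of the space of matrices, so a monomial on it pulls back to a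
  product of minors of a freely chosen matrix.\<close>

lemma lin_indep_on_grass_cone_iff:
  "lin_indep_on d N (grass_cone d N) M \<longleftrightarrow>
     (\<forall>c. (\<forall>u. (\<Sum>\<alpha>\<in>M. c \<alpha> * minor_product d N \<alpha> u) = 0) \<longrightarrow> (\<forall>\<alpha>\<in>M. c \<alpha> = 0))"
proof -
  define pt where "pt v = (\<lambda>S. if S \<in> plucker_index d N then plucker_coord d v S else 0)" for v
  have cone: "grass_cone d N = range pt"
    by (auto simp: grass_cone_def pt_def fun_eq_iff image_iff)
  have "eval_monomial d N \<alpha> (pt v) = minor_product d N \<alpha> (\<lambda>(i, l). v i l)" for \<alpha> v
    by (simp add: eval_monomial_def minor_product_def minor_def pt_def)
  then have "(\<forall>p\<in>grass_cone d N. (\<Sum>\<alpha>\<in>M. c \<alpha> * eval_monomial d N \<alpha> p) = 0) \<longleftrightarrow>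
      (\<forall>v. (\<Sum>\<alpha>\<in>M. c \<alpha> * minor_product d N \<alpha> (\<lambda>(i, l). v i l)) = 0)" for c
    by (simp add: cone)
  also have "\<dots> c \<longleftrightarrow> (\<forall>u. (\<Sum>\<alpha>\<in>M. c \<alpha> * minor_product d N \<alpha> u) = 0)" for c
    by (metis case_prod_curry curry_def)
  finally show ?thesis by (simp add: lin_indep_on_def)
qed

lemma det_mat_eq:
  "det (mat n n (\<lambda>(i, j). f i j)) = (\<Sum>p | p permutes {0..<n}. of_int (sign p) * (\<Prod>i<n. f i (p i)))"
proof -
  have "i < n \<Longrightarrow> p permutes {0..<n} \<Longrightarrow> p i < n" for i p
    using permutes_in_image[of p "{0..<n}" i] by auto
  then show ?thesis
    by (auto simp: det_def'[of _ n] lessThan_atLeast0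
        intro!: sum.cong prod.cong arg_cong2[where f = "(*)"])
qed

lemma minor_eq_det:
  "minor d u S = det (mat d d (\<lambda>(i, j). u (i, sorted_list_of_set S ! j)))"
  by (simp add: minor_def plucker_coord_def det_mat_eq)

lemma minor_add_row:
  assumes "r \<noteq> s" "s < d"
  shows "minor d (add_row r s w u) S = minor d u S"
proof -
  let ?A = "mat d d (\<lambda>(i, j). u (i, sorted_list_of_set S ! j))"
  have "mat d d (\<lambda>(i, j). add_row r s w u (i, sorted_list_of_set S ! j)) = addrow w r s ?A"
    using assms by (intro eq_matI) (auto simp: add_row_def add.commute)
  moreover have "det (addrow w r s ?A) = det ?A"
    using assms by (intro det_addrow[of _ d]) auto
  ultimately show ?thesis by (simp add: minor_eq_det)
qed

section \<open>Functions homogeneous of the same degree in every row\<close>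

definition row_homogeneous :: "nat \<Rightarrow> nat \<Rightarrow> nat \<Rightarrow> ((nat \<times> nat \<Rightarrow> complex) \<Rightarrow> complex) \<Rightarrow> bool" where
  "row_homogeneous d N k f \<longleftrightarrow> (\<exists>c. \<forall>u. f u = (\<Sum>A\<in>exps d N k. c A * power_prod (grid d N) A u))"

lemma row_homogeneous_power_prod:
  assumes "A \<in> exps d N k"
  shows "row_homogeneous d N k (power_prod (grid d N) A)"
  unfolding row_homogeneous_def
proof (intro exI[of _ "\<lambda>B. if B = A then 1 else 0"] allI)
  fix u :: "nat \<times> nat \<Rightarrow> complex"
  have "(\<Sum>B\<in>exps d N k. (if B = A then 1 else 0) * power_prod (grid d N) B u) =
      (\<Sum>B\<in>exps d N k. if B = A then power_prod (grid d N) A u else 0)"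
    by (intro sum.cong) auto
  then show "power_prod (grid d N) A u = (\<Sum>B\<in>exps d N k. (if B = A then 1 else 0) * power_prod (grid d N) B u)"
    using assms by simp
qed

lemma row_homogeneous_cmult:
  assumes "row_homogeneous d N k f"
  shows "row_homogeneous d N k (\<lambda>u. a * f u)"
proof -
  obtain c where "\<And>u. f u = (\<Sum>A\<in>exps d N k. c A * power_prod (grid d N) A u)"
    using assms by (auto simp: row_homogeneous_def)
  then show ?thesis unfolding row_homogeneous_def
    by (intro exI[of _ "\<lambda>A. a * c A"]) (simp add: sum_distrib_left mult.assoc)
qed

lemma row_homogeneous_sum:
  assumes "\<And>x. x \<in> P \<Longrightarrow> row_homogeneous d N k (f x)"
  shows "row_homogeneous d N k (\<lambda>u. \<Sum>x\<in>P. f x u)"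
proof -
  have "\<forall>x\<in>P. \<exists>c. \<forall>u. f x u = (\<Sum>A\<in>exps d N k. c A * power_prod (grid d N) A u)"
    using assms by (auto simp: row_homogeneous_def)
  then obtain c where "\<forall>x\<in>P. \<forall>u. f x u = (\<Sum>A\<in>exps d N k. c x A * power_prod (grid d N) A u)"
    by metis
  then show ?thesis unfolding row_homogeneous_def
    by (intro exI[of _ "\<lambda>A. \<Sum>x\<in>P. c x A"]) (simp add: sum_distrib_right sum.swap[of _ _ P])
qed

lemma row_homogeneous_mult:
  assumes "row_homogeneous d N k f" "row_homogeneous d N m g"
  shows "row_homogeneous d N (k + m) (\<lambda>u. f u * g u)"
proof -
  obtain c where c: "\<And>u. f u = (\<Sum>A\<in>exps d N k. c A * power_prod (grid d N) A u)"
    using assms by (auto simp: row_homogeneous_def)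
  obtain e where e: "\<And>u. g u = (\<Sum>A\<in>exps d N m. e A * power_prod (grid d N) A u)"
    using assms by (auto simp: row_homogeneous_def)
  have eq: "(\<lambda>u. f u * g u) = (\<lambda>u. \<Sum>A\<in>exps d N k. \<Sum>B\<in>exps d N m.
      (c A * e B) * power_prod (grid d N) (\<lambda>x. A x + B x) u)"
    by (auto simp: c e sum_product power_prod_add mult_ac)
  show ?thesis unfolding eq
    by (intro row_homogeneous_sum row_homogeneous_cmult row_homogeneous_power_prod)
      (auto simp: exps_def sum.distrib)
qed

lemma row_homogeneous_one: "row_homogeneous d N 0 (\<lambda>_. 1)"
proof -
  have "row_homogeneous d N 0 (power_prod (grid d N) (\<lambda>_. 0))"
    by (rule row_homogeneous_power_prod) (auto simp: exps_def)
  then show ?thesis by (simp add: power_prod_def[abs_def])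
qed

lemma row_homogeneous_power:
  "row_homogeneous d N k f \<Longrightarrow> row_homogeneous d N (n * k) (\<lambda>u. f u ^ n)"
  by (induction n) (auto intro: row_homogeneous_mult row_homogeneous_one)

lemma row_homogeneous_prod:
  assumes "finite P" "\<And>x. x \<in> P \<Longrightarrow> row_homogeneous d N (k x) (f x)"
  shows "row_homogeneous d N (\<Sum>x\<in>P. k x) (\<lambda>u. \<Prod>x\<in>P. f x u)"
  using assms
  by (induction P rule: finite_induct) (auto intro: row_homogeneous_mult row_homogeneous_one)

lemma prod_eq_power_prod_grid:
  fixes u :: "nat \<times> nat \<Rightarrow> 'a :: comm_semiring_1"
  assumes "\<And>i. i < d \<Longrightarrow> f i < N"
  shows "(\<Prod>i<d. u (i, f i)) = power_prod (grid d N) (\<lambda>(i, l). if i < d \<and> l = f i then 1 else 0) u"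
proof -
  have "power_prod (grid d N) (\<lambda>(i, l). if i < d \<and> l = f i then 1 else 0) u =
      (\<Prod>i<d. \<Prod>l<N. if l = f i then u (i, l) else 1)"
    unfolding power_prod_def grid_def prod.cartesian_product by (intro prod.cong) auto
  also have "\<dots> = (\<Prod>i<d. u (i, f i))"
    using assms by (intro prod.cong refl) (simp add: prod.delta)
  finally show ?thesis ..
qed

text \<open>Each Leibniz term takes exactly one entry from every row.\<close>

lemma row_homogeneous_minor:
  assumes S: "S \<in> plucker_index d N"
  shows "row_homogeneous d N 1 (\<lambda>u. minor d u S)"
proof -
  let ?xs = "sorted_list_of_set S"
  let ?A = "\<lambda>p (i, l). if i < d \<and> l = ?xs ! p i then 1 else (0::nat)"
  have lt: "?xs ! p i < N" if "p permutes {0..<d}" "i < d" for p i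
    using sorted_list_plucker_index(2)[OF S, of "p i"] permutes_in_image[OF that(1), of i] that by auto
  have eq: "(\<lambda>u. minor d u S) = (\<lambda>u. \<Sum>p | p permutes {0..<d}. of_int (sign p) * power_prod (grid d N) (?A p) u)"
    unfolding minor_def plucker_coord_def
    by (intro ext sum.cong refl arg_cong2[where f = "(*)"] prod_eq_power_prod_grid) (use lt in auto)
  show ?thesis unfolding eq
  proof (intro row_homogeneous_sum row_homogeneous_cmult row_homogeneous_power_prod)
    fix p assume "p \<in> {p. p permutes {0..<d}}"
    then have lt: "?xs ! p i < N" if "i < d" for i using lt that by blast
    then show "?A p \<in> exps d N 1" by (auto simp: exps_def grid_def)
  qed
qed

lemma row_homogeneous_minor_product:
  assumes "\<alpha> \<in> monomials d N k"
  shows "row_homogeneous d N k (minor_product d N \<alpha>)"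
proof -
  have "row_homogeneous d N (\<Sum>S\<in>plucker_index d N. \<alpha> S * 1) (minor_product d N \<alpha>)"
    unfolding minor_product_def
    by (intro row_homogeneous_prod row_homogeneous_power row_homogeneous_minor) auto
  then show ?thesis using assms by (simp add: monomials_def)
qed

text \<open>A row-invariant polynomial is determined by its ballot coefficients: a heaviest exponent
  in its support would be ballot, where the coefficient is zero.\<close>

lemma row_invariant_eq_zero:
  assumes F: "\<And>u. F u = (\<Sum>A\<in>exps d N k. g A * power_prod (grid d N) A u)"
    and inv: "\<And>r u w. Suc r < d \<Longrightarrow> F (add_row (Suc r) r w u) = F u"
    and zero: "\<And>A. A \<in> exps d N k \<Longrightarrow> ballot d N A \<Longrightarrow> g A = 0"
  shows "F u = 0"
proof (rule ccontr)
  assume "F u \<noteq> 0"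
  then obtain A1 where A1: "A1 \<in> exps d N k" "g A1 \<noteq> 0"
    unfolding F by (metis (no_types, lifting) mult_eq_0_iff sum.neutral)
  \<comment> \<open>Extension by zero, as nothing is known of \<open>g\<close> outside
    \<open>exps d N k\<close>.\<close>
  define h where "h A = (if A \<in> exps d N k then g A else 0)" for A
  let ?X = "{A \<in> exps d N k. h A \<noteq> 0}"
  have "finite ?X" "?X \<noteq> {}" using A1 by (auto simp: h_def)
  then obtain A where A: "A \<in> ?X" "\<And>B. B \<in> ?X \<Longrightarrow> wt d N (Suc k) B \<le> wt d N (Suc k) A"
    using Max_ge[of "wt d N (Suc k) ` ?X"] Max_in[of "wt d N (Suc k) ` ?X"] by fastforce
  have "ballot d N A"
  proof (rule ballot_of_max_weight[where g = h])
    show "(\<Sum>l | l < N \<and> B (r, l) > 0. of_nat (Suc (B (Suc r, l))) * h (drop_box r l B)) = 0"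
      if "Suc r < d" for r B
    proof (rule row_invariant_coeff_relation[where F = F and k = k, OF that inv[OF that]])
      show "F u = (\<Sum>A\<in>exps d N k. h A * power_prod (grid d N) A u)" for u
        unfolding F h_def by (rule sum.cong) auto
    qed (simp add: h_def)
  qed (use A in \<open>auto simp: h_def split: if_splits\<close>)
  then show False using A zero by (auto simp: h_def)
qed

lemma finite_monomials [simp]: "finite (monomials d N k)"
proof (rule finite_subset)
  show "monomials d N k \<subseteq> {\<alpha>. \<forall>S. (S \<in> plucker_index d N \<longrightarrow> \<alpha> S \<in> {..k}) \<and>
      (S \<notin> plucker_index d N \<longrightarrow> \<alpha> S = 0)}"
    by (auto simp: monomials_def intro: member_le_sum)
  show "finite {\<alpha>. \<forall>S. (S \<in> plucker_index d N \<longrightarrow> \<alpha> S \<in> {..k}) \<and>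
      (S \<notin> plucker_index d N \<longrightarrow> \<alpha> S = (0::nat))}"
    by (rule finite_set_of_finite_funs) auto
qed

text \<open>With more products than ballot exponents, some nontrivial combination has all ballot
  coefficients zero. Minors are invariant under row additions, so this combination vanishes
  identically.\<close>

lemma card_lin_indep_le:
  assumes M: "M \<subseteq> monomials d N k" and indep: "lin_indep_on d N (grass_cone d N) M"
  shows "card M \<le> card {A \<in> exps d N k. ballot d N A}"
proof (rule ccontr)
  let ?E = "{A \<in> exps d N k. ballot d N A}"
  assume "\<not> card M \<le> card ?E"
  have finM: "finite M" using M by (rule finite_subset) simp
  have "\<forall>\<alpha>\<in>M. \<exists>a. \<forall>u. minor_product d N \<alpha> u = (\<Sum>A\<in>exps d N k. a A * power_prod (grid d N) A u)"
    using row_homogeneous_minor_product M unfolding row_homogeneous_def by blast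
  then obtain a where a: "\<And>\<alpha> u. \<alpha> \<in> M \<Longrightarrow>
      minor_product d N \<alpha> u = (\<Sum>A\<in>exps d N k. a \<alpha> A * power_prod (grid d N) A u)"
    by metis
  obtain c where c: "\<exists>\<alpha>\<in>M. c \<alpha> \<noteq> 0" "\<forall>A\<in>?E. (\<Sum>\<alpha>\<in>M. c \<alpha> * a \<alpha> A) = 0"
    using underdetermined_system_nontrivial_solution[of ?E M "\<lambda>A \<alpha>. a \<alpha> A"]
      \<open>\<not> card M \<le> card ?E\<close> finM by auto
  define F where "F u = (\<Sum>\<alpha>\<in>M. c \<alpha> * minor_product d N \<alpha> u)" for u
  have "F u = 0" for u
  proof (rule row_invariant_eq_zero[where F = F and k = k and g = "\<lambda>A. \<Sum>\<alpha>\<in>M. c \<alpha> * a \<alpha> A"])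
    show "F u = (\<Sum>A\<in>exps d N k. (\<Sum>\<alpha>\<in>M. c \<alpha> * a \<alpha> A) * power_prod (grid d N) A u)" for u
      by (simp add: F_def a sum_distrib_left sum_distrib_right sum.swap[of _ M] mult.assoc)
    show "F (add_row (Suc r) r w u) = F u" if "Suc r < d" for r u w
      using that by (simp add: F_def minor_product_def minor_add_row)
  qed (use c in auto)
  then show False using indep c unfolding lin_indep_on_grass_cone_iff F_def by blast
qed

section \<open>Lower bound for the dimension\<close>

text \<open>Stated for degree bounds instead of degrees, because the top coefficients used later are
  power products that may vanish at particular matrices.\<close>

lemma coeff_mult_top:
  fixes p q :: "'a :: comm_semiring_1 poly"
  assumes "degree p \<le> m" "degree q \<le> n"
  shows "coeff (p * q) (m + n) = coeff p m * coeff q n"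
proof (cases "degree p = m \<and> degree q = n")
  case True
  then show ?thesis using coeff_mult_degree_sum[of p q] by simp
next
  case False
  then have "degree p < m \<or> degree q < n" using assms by auto
  then have "coeff p m * coeff q n = 0" by (auto simp: coeff_eq_0)
  moreover have "degree (p * q) < m + n"
    using degree_mult_le[of p q] \<open>degree p < m \<or> degree q < n\<close> assms by linarith
  ultimately show ?thesis by (simp add: coeff_eq_0)
qed

lemma coeff_power_top:
  fixes p :: "'a :: comm_semiring_1 poly"
  assumes "degree p \<le> m"
  shows "degree (p ^ e) \<le> e * m \<and> coeff (p ^ e) (e * m) = coeff p m ^ e"
proof (induction e)
  case (Suc e)
  then show ?case using assms coeff_mult_top[of p m "p ^ e" "e * m"] degree_mult_le[of p "p ^ e"]
    by auto
qed simp

lemma coeff_prod_top: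
  fixes p :: "'b \<Rightarrow> 'a :: comm_semiring_1 poly"
  assumes "finite P" "\<And>x. x \<in> P \<Longrightarrow> degree (p x) \<le> m x"
  shows "degree (\<Prod>x\<in>P. p x) \<le> (\<Sum>x\<in>P. m x) \<and>
    coeff (\<Prod>x\<in>P. p x) (\<Sum>x\<in>P. m x) = (\<Prod>x\<in>P. coeff (p x) (m x))"
  using assms
proof (induction P rule: finite_induct)
  case (insert x P)
  then have IH: "degree (\<Prod>x\<in>P. p x) \<le> (\<Sum>x\<in>P. m x)" "degree (p x) \<le> m x"
    "coeff (\<Prod>x\<in>P. p x) (\<Sum>x\<in>P. m x) = (\<Prod>x\<in>P. coeff (p x) (m x))"
    by auto
  then show ?case using insert.hyps coeff_mult_top[of "p x" "m x" "\<Prod>x\<in>P. p x" "\<Sum>x\<in>P. m x"]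
      degree_mult_le[of "p x" "\<Prod>x\<in>P. p x"]
    by auto
qed simp

section \<open>Diagonal leading terms of minors\<close>

definition minor_weight :: "nat \<Rightarrow> nat \<Rightarrow> nat set \<Rightarrow> nat" where
  "minor_weight d N S = (\<Sum>i<d. N ^ i * (sorted_list_of_set S ! i))"

text \<open>The minor after scaling the entry at \<open>(i, l)\<close> by
  \<open>t ^ (N ^ i * l)\<close>, as a polynomial in \<open>t\<close>; the degree in
  \<open>t\<close> plays the part of a term order.\<close>

definition weighted_minor :: "nat \<Rightarrow> nat \<Rightarrow> (nat \<times> nat \<Rightarrow> complex) \<Rightarrow> nat set \<Rightarrow> complex poly" where
  "weighted_minor d N u S = (\<Sum>p | p permutes {0..<d}.
     monom (of_int (sign p) * (\<Prod>i<d. u (i, sorted_list_of_set S ! p i)))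
       (\<Sum>i<d. N ^ i * (sorted_list_of_set S ! p i)))"

lemma poly_weighted_minor:
  "poly (weighted_minor d N u S) t = minor d (\<lambda>(i, l). t ^ (N ^ i * l) * u (i, l)) S"
  by (simp add: weighted_minor_def minor_def plucker_coord_def poly_sum poly_monom
      prod.distrib power_sum mult_ac)

text \<open>The weight is a base \<open>N\<close> number whose digits are the chosen columns. At the
  largest index moved by \<open>p\<close> the digit drops, and all higher digits agree with the
  diagonal.\<close>

lemma diagonal_weight_less:
  assumes S: "S \<in> plucker_index d N" and p: "p permutes {0..<d}" "p \<noteq> id"
  shows "(\<Sum>i<d. N ^ i * (sorted_list_of_set S ! p i)) < minor_weight d N S"
proof -
  let ?xs = "sorted_list_of_set S"
  let ?D = "{i. i < d \<and> p i \<noteq> i}"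
  define m where "m = Max ?D"
  have "?D \<noteq> {}"
  proof
    assume "?D = {}"
    then have "p i = i" for i using permutes_not_in[OF p(1), of i] by (cases "i < d") auto
    then show False using p(2) by auto
  qed
  then have m: "m < d" "p m \<noteq> m" using Max_in[of ?D] by (auto simp: m_def)
  have fixed: "p i = i" if "m < i" for i
  proof (cases "i < d")
    case True
    then show ?thesis using Max_ge[of ?D i] that by (fastforce simp: m_def[symmetric])
  next
    case False
    then show ?thesis using permutes_not_in[OF p(1), of i] by simp
  qed
  have lt: "p i < d" if "i < d" for i
    using permutes_in_image[OF p(1), of i] that by simp
  \<comment> \<open>All indices above \<open>m\<close> are fixed points, so injectivity forbids
    \<open>p m > m\<close>.\<close>
  have "p m < m"
  proof (rule ccontr)
    assume "\<not> p m < m"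
    then have "p (p m) = p m" using m fixed by simp
    then show False using m permutes_inj[OF p(1)] by (auto dest: injD)
  qed
  moreover have "sorted_wrt (<) ?xs" using strict_sorted_list_of_set by auto
  ultimately have "?xs ! p m < ?xs ! m"
    using m sorted_list_plucker_index(1)[OF S] by (auto intro: sorted_wrt_nth_less)
  then show ?thesis unfolding minor_weight_def
    using m lt sorted_list_plucker_index(2)[OF S] fixed
    by (intro digit_sum_less[of _ _ _ m]) auto
qed

text \<open>The identity permutation alone attains the top weight, and its sign is one.\<close>

lemma weighted_minor_top:
  assumes S: "S \<in> plucker_index d N"
  shows "degree (weighted_minor d N u S) \<le> minor_weight d N S"
    "coeff (weighted_minor d N u S) (minor_weight d N S) = (\<Prod>i<d. u (i, sorted_list_of_set S ! i))"
proof -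
  let ?P = "{p. p permutes {0..<d}}" and ?xs = "sorted_list_of_set S"
  let ?w = "\<lambda>p. \<Sum>i<d. N ^ i * (?xs ! p i)"
  have fin: "finite ?P" by (simp add: finite_permutations)
  have id: "?w id = minor_weight d N S" by (simp add: minor_weight_def)
  have le: "?w p \<le> minor_weight d N S" if "p \<in> ?P" for p
    using diagonal_weight_less[OF S, of p] that id by (cases "p = id") auto
  show "degree (weighted_minor d N u S) \<le> minor_weight d N S"
    unfolding weighted_minor_def
  proof (intro degree_sum_le fin)
    fix p assume p: "p \<in> ?P"
    show "degree (monom (of_int (sign p) * (\<Prod>i<d. u (i, ?xs ! p i))) (?w p)) \<le> minor_weight d N S"
      using degree_monom_le le[OF p] by (rule order_trans)
  qed
  have "coeff (weighted_minor d N u S) (minor_weight d N S) =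
      (\<Sum>p\<in>?P. if p = id then (\<Prod>i<d. u (i, ?xs ! i)) else 0)"
    unfolding weighted_minor_def coeff_sum
  proof (intro sum.cong refl)
    fix p assume p: "p \<in> ?P"
    show "coeff (monom (of_int (sign p) * (\<Prod>i<d. u (i, ?xs ! p i))) (?w p)) (minor_weight d N S) =
        (if p = id then (\<Prod>i<d. u (i, ?xs ! i)) else 0)"
      using diagonal_weight_less[OF S, of p] p id by (cases "p = id") (auto simp: sign_id)
  qed
  also have "\<dots> = (\<Prod>i<d. u (i, ?xs ! i))" using fin by (simp add: sum.delta permutes_id)
  finally show "coeff (weighted_minor d N u S) (minor_weight d N S) = (\<Prod>i<d. u (i, ?xs ! i))" .
qed

text \<open>The exponent of the leading monomial of \<open>minor_product d N \<alpha>\<close>: the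
  product of the diagonal terms of its minors.\<close>

definition diagonal_exponent :: "nat \<Rightarrow> nat \<Rightarrow> (nat set \<Rightarrow> nat) \<Rightarrow> nat \<times> nat \<Rightarrow> nat" where
  "diagonal_exponent d N \<alpha> = (\<lambda>(i, l). if i < d then
     (\<Sum>S\<in>plucker_index d N. if sorted_list_of_set S ! i = l then \<alpha> S else 0) else 0)"

lemma diagonal_exponent_outside: "x \<notin> grid d N \<Longrightarrow> diagonal_exponent d N \<alpha> x = 0"
  using sorted_list_plucker_index(2)[of _ d N]
  by (cases x) (fastforce simp: diagonal_exponent_def grid_def intro!: sum.neutral)

lemma power_prod_diagonal_exponent:
  "(\<Prod>S\<in>plucker_index d N. (\<Prod>i<d. u (i, sorted_list_of_set S ! i)) ^ \<alpha> S) =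
     power_prod (grid d N) (diagonal_exponent d N \<alpha>) (u :: nat \<times> nat \<Rightarrow> complex)"
proof -
  have "power_prod (grid d N) (diagonal_exponent d N \<alpha>) u =
      (\<Prod>(i, l)\<in>grid d N. \<Prod>S\<in>plucker_index d N. u (i, l) ^ (if sorted_list_of_set S ! i = l then \<alpha> S else 0))"
    unfolding power_prod_def
    by (intro prod.cong refl) (auto simp: diagonal_exponent_def power_sum grid_def)
  also have "\<dots> = (\<Prod>S\<in>plucker_index d N. \<Prod>(i, l)\<in>grid d N. u (i, l) ^ (if sorted_list_of_set S ! i = l then \<alpha> S else 0))"
    unfolding case_prod_unfold by (rule prod.swap)
  also have "\<dots> = (\<Prod>S\<in>plucker_index d N. (\<Prod>i<d. u (i, sorted_list_of_set S ! i)) ^ \<alpha> S)"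
  proof (intro prod.cong refl)
    fix S assume S: "S \<in> plucker_index d N"
    have "(\<Prod>(i, l)\<in>grid d N. u (i, l) ^ (if sorted_list_of_set S ! i = l then \<alpha> S else 0)) =
        (\<Prod>i<d. \<Prod>l<N. if sorted_list_of_set S ! i = l then u (i, l) ^ \<alpha> S else 1)"
      unfolding grid_def prod.cartesian_product by (intro prod.cong) auto
    also have "\<dots> = (\<Prod>i<d. u (i, sorted_list_of_set S ! i) ^ \<alpha> S)"
      using sorted_list_plucker_index(2)[OF S] by (intro prod.cong refl) (simp add: prod.delta')
    finally show "(\<Prod>(i, l)\<in>grid d N. u (i, l) ^ (if sorted_list_of_set S ! i = l then \<alpha> S else 0)) =
        (\<Prod>i<d. u (i, sorted_list_of_set S ! i)) ^ \<alpha> S"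
      by (simp add: prod_power_distrib)
  qed
  finally show ?thesis ..
qed

text \<open>In a vanishing combination, take the top power of \<open>t\<close> among the terms with
  nonzero coefficient. Its coefficient is a combination of leading monomials, which are distinct by
  injectivity and hence independent.\<close>

lemma lin_indep_of_inj_diagonal_exponent:
  assumes fin: "finite M" and inj: "inj_on (diagonal_exponent d N) M"
  shows "lin_indep_on d N (grass_cone d N) M"
  unfolding lin_indep_on_grass_cone_iff
proof (intro allI impI)
  fix c assume zero: "\<forall>u. (\<Sum>\<alpha>\<in>M. c \<alpha> * minor_product d N \<alpha> u) = 0"
  define w where "w \<alpha> = (\<Sum>S\<in>plucker_index d N. \<alpha> S * minor_weight d N S)" for \<alpha> :: "nat set \<Rightarrow> nat"
  define Q where "Q u \<alpha> = (\<Prod>S\<in>plucker_index d N. weighted_minor d N u S ^ \<alpha> S)" for u \<alpha>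
  have Q: "degree (Q u \<alpha>) \<le> w \<alpha>"
    "coeff (Q u \<alpha>) (w \<alpha>) = power_prod (grid d N) (diagonal_exponent d N \<alpha>) u" for u \<alpha>
  proof -
    have "degree (Q u \<alpha>) \<le> w \<alpha> \<and> coeff (Q u \<alpha>) (w \<alpha>) =
        (\<Prod>S\<in>plucker_index d N. coeff (weighted_minor d N u S ^ \<alpha> S) (\<alpha> S * minor_weight d N S))"
      unfolding Q_def w_def by (intro coeff_prod_top) (simp_all add: coeff_power_top weighted_minor_top(1))
    moreover have "(\<Prod>S\<in>plucker_index d N. coeff (weighted_minor d N u S ^ \<alpha> S) (\<alpha> S * minor_weight d N S)) =
        (\<Prod>S\<in>plucker_index d N. (\<Prod>i<d. u (i, sorted_list_of_set S ! i)) ^ \<alpha> S)"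
      using weighted_minor_top by (intro prod.cong refl) (simp add: coeff_power_top)
    ultimately show "degree (Q u \<alpha>) \<le> w \<alpha>"
      "coeff (Q u \<alpha>) (w \<alpha>) = power_prod (grid d N) (diagonal_exponent d N \<alpha>) u"
      by (simp_all add: power_prod_diagonal_exponent)
  qed
  show "\<forall>\<alpha>\<in>M. c \<alpha> = 0"
  proof (rule ccontr)
    assume "\<not> (\<forall>\<alpha>\<in>M. c \<alpha> = 0)"
    then have ne: "{\<alpha> \<in> M. c \<alpha> \<noteq> 0} \<noteq> {}" by auto
    define m where "m = Max (w ` {\<alpha> \<in> M. c \<alpha> \<noteq> 0})"
    have "m \<in> w ` {\<alpha> \<in> M. c \<alpha> \<noteq> 0}" unfolding m_def using ne fin by (intro Max_in) auto
    then obtain \<alpha>0 where \<alpha>0: "\<alpha>0 \<in> M" "c \<alpha>0 \<noteq> 0" "w \<alpha>0 = m" by auto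
    \<comment> \<open>Members with \<open>c \<alpha> = 0\<close> are harmless: they contribute zero
      to the coefficient at \<open>m\<close>.\<close>
    let ?M = "{\<alpha> \<in> M. w \<alpha> = m}"
    have "(\<Sum>\<alpha>\<in>?M. c \<alpha> * power_prod (grid d N) (diagonal_exponent d N \<alpha>) u) = 0" for u
    proof -
      define p where "p = (\<Sum>\<alpha>\<in>M. Polynomial.smult (c \<alpha>) (Q u \<alpha>))"
      have "poly p t = 0" for t
      proof -
        have "poly p t = (\<Sum>\<alpha>\<in>M. c \<alpha> * minor_product d N \<alpha> (\<lambda>(i, l). t ^ (N ^ i * l) * u (i, l)))"
          by (simp add: p_def poly_sum Q_def poly_prod poly_weighted_minor minor_product_def)
        then show ?thesis using zero by simp
      qed
      then have "p = 0" using poly_all_0_iff_0 by blast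
      then have "0 = coeff p m" by simp
      also have "\<dots> = (\<Sum>\<alpha>\<in>M. if w \<alpha> = m then
          c \<alpha> * power_prod (grid d N) (diagonal_exponent d N \<alpha>) u else 0)"
        unfolding p_def coeff_sum
      proof (intro sum.cong refl)
        fix \<alpha> assume \<alpha>: "\<alpha> \<in> M"
        show "coeff (Polynomial.smult (c \<alpha>) (Q u \<alpha>)) m = (if w \<alpha> = m then
            c \<alpha> * power_prod (grid d N) (diagonal_exponent d N \<alpha>) u else 0)"
        proof (cases "c \<alpha> = 0 \<or> w \<alpha> = m")
          case True
          then show ?thesis using Q(2)[of u \<alpha>] by auto
        next
          case False
          then have "w \<alpha> \<le> m" unfolding m_def using \<alpha> fin by (intro Max_ge) auto
          then have "degree (Q u \<alpha>) < m" using False Q(1)[of u \<alpha>] by linarith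
          then show ?thesis using False by (simp add: coeff_eq_0)
        qed
      qed
      also have "\<dots> = (\<Sum>\<alpha>\<in>?M. c \<alpha> * power_prod (grid d N) (diagonal_exponent d N \<alpha>) u)"
        using fin by (simp add: sum.inter_filter)
      finally show ?thesis by simp
    qed
    then have "(\<Sum>\<alpha> | \<alpha> \<in> ?M \<and> diagonal_exponent d N \<alpha> = diagonal_exponent d N \<alpha>0. c \<alpha>) = 0"
      using fin diagonal_exponent_outside by (intro power_prod_family_coeff_zero[of "grid d N" ?M]) auto
    moreover have "{\<alpha>. \<alpha> \<in> ?M \<and> diagonal_exponent d N \<alpha> = diagonal_exponent d N \<alpha>0} = {\<alpha>0}"
      using \<alpha>0 inj by (auto dest: inj_onD)
    ultimately show False using \<alpha>0 by simp
  qed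
qed

text \<open>The columns of the tableau of \<open>A\<close> are \<open>d\<close>-element sets, and
  \<open>\<alpha>\<close> counts how often each set occurs. The diagonal terms of the corresponding
  minors recover the rows.\<close>

lemma ex_monomial_of_ballot:
  assumes A: "A \<in> exps d N k" and bal: "ballot d N A"
  shows "\<exists>\<alpha>\<in>monomials d N k. diagonal_exponent d N \<alpha> = A"
proof -
  \<comment> \<open>Read \<open>A\<close> as a tableau whose row \<open>i\<close> contains \<open>A (i, l)\<close> copies of \<open>l\<close>;
    \<open>T i c\<close> is its entry in row \<open>i\<close> and column \<open>c\<close>.\<close>
  define T where "T i c = (LEAST l. c < (\<Sum>l'\<le>l. A (i, l')))" for i c
  have T_ex: "c < (\<Sum>l'\<le>N - 1. A (i, l'))" "N > 0" if "i < d" "c < k" for i c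
  proof -
    have sum: "(\<Sum>l<N. A (i, l)) = k" using A that by (auto simp: exps_def)
    then show "N > 0" using that by (cases N) auto
    then have "{..N - 1} = {..<N}" by auto
    then show "c < (\<Sum>l'\<le>N - 1. A (i, l'))" using sum that by simp
  qed
  have T_lt: "c < (\<Sum>l'\<le>T i c. A (i, l'))" if "i < d" "c < k" for i c
    unfolding T_def by (rule LeastI[of _ "N - 1"]) (rule T_ex[OF that])
  have T_N: "T i c < N" if "i < d" "c < k" for i c
    using Least_le[of "\<lambda>l. c < (\<Sum>l'\<le>l. A (i, l'))" "N - 1"] T_ex[OF that] by (simp add: T_def)
  \<comment> \<open>The copies of \<open>l\<close> in row \<open>i\<close> occupy the columns
    between two consecutive partial sums.\<close>
  have T_iff: "T i c = l \<longleftrightarrow> (\<Sum>l'<l. A (i, l')) \<le> c \<and> c < (\<Sum>l'\<le>l. A (i, l'))"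
    if ic: "i < d" "c < k" for i c l
  proof
    assume l: "T i c = l"
    have "(\<Sum>l'<l. A (i, l')) \<le> c"
    proof (cases l)
      case (Suc m)
      then have "\<not> c < (\<Sum>l'\<le>m. A (i, l'))" using l unfolding T_def by (intro not_less_Least) auto
      then show ?thesis using Suc by (simp add: lessThan_Suc_atMost)
    qed simp
    then show "(\<Sum>l'<l. A (i, l')) \<le> c \<and> c < (\<Sum>l'\<le>l. A (i, l'))" using T_lt[OF ic] l by simp
  next
    assume l: "(\<Sum>l'<l. A (i, l')) \<le> c \<and> c < (\<Sum>l'\<le>l. A (i, l'))"
    have "T i c \<le> l" unfolding T_def using l by (intro Least_le) auto
    moreover have "\<not> T i c < l"
    proof
      assume "T i c < l"
      then have "(\<Sum>l'\<le>T i c. A (i, l')) \<le> (\<Sum>l'<l. A (i, l'))" by (intro sum_mono2) auto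
      then show False using l T_lt[OF ic] by simp
    qed
    ultimately show "T i c = l" by simp
  qed
  \<comment> \<open>The ballot inequality at \<open>j = T (Suc i) c\<close> shows that more than
    \<open>c\<close> entries of row \<open>i\<close> are smaller than \<open>j\<close>.\<close>
  have T_step: "T i c < T (Suc i) c" if "Suc i < d" "c < k" for i c
  proof -
    have "c < (\<Sum>l\<le>T (Suc i) c. A (Suc i, l))" using T_lt that by simp
    also have "\<dots> \<le> (\<Sum>l<T (Suc i) c. A (i, l))"
      using bal that T_N[of "Suc i" c] by (auto simp: ballot_def)
    finally have c: "c < (\<Sum>l<T (Suc i) c. A (i, l))" .
    then obtain m where m: "T (Suc i) c = Suc m" by (cases "T (Suc i) c") auto
    have "T i c \<le> m" unfolding T_def using c m by (intro Least_le) (simp add: lessThan_Suc_atMost)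
    then show ?thesis using m by simp
  qed
  have T_mono: "T i c < T j c" if "i < j" "j < d" "c < k" for i j c
    using that
  proof (induction j)
    case (Suc j)
    then show ?case using T_step[of j c] by (cases "i = j") auto
  qed simp
  define col where "col c = (\<lambda>i. T i c) ` {..<d}" for c
  have sorted_col: "sorted_list_of_set (col c) = map (\<lambda>i. T i c) [0..<d]" if c: "c < k" for c
  proof -
    have "sorted_wrt (<) (map (\<lambda>i. T i c) [0..<d])"
      using T_mono c by (auto simp: sorted_wrt_iff_nth_less)
    moreover have "set (map (\<lambda>i. T i c) [0..<d]) = col c" by (auto simp: col_def)
    ultimately show ?thesis
      by (metis sorted_list_of_set.idem_if_sorted_distinct strict_sorted_iff)
  qed
  have col_index: "col c \<in> plucker_index d N" if c: "c < k" for c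
  proof -
    have "card (col c) = length (sorted_list_of_set (col c))" by (simp add: col_def)
    then have "card (col c) = d" using sorted_col[OF c] by simp
    then show ?thesis using T_N c by (auto simp: plucker_index_def col_def)
  qed
  define \<alpha> where "\<alpha> S = card {c. c < k \<and> col c = S}" for S
  have \<alpha>_sum: "(\<Sum>S\<in>plucker_index d N. if P S then \<alpha> S else 0) = card {c. c < k \<and> P (col c)}" for P
  proof -
    have "(\<Sum>S\<in>plucker_index d N. if P S then \<alpha> S else 0) =
        (\<Sum>S\<in>plucker_index d N. \<Sum>c | c \<in> {..<k} \<and> col c = S. if P (col c) then 1 else 0)"
      by (intro sum.cong refl) (simp add: \<alpha>_def)
    also have "\<dots> = (\<Sum>c<k. if P (col c) then 1 else 0)"
      using col_index by (intro sum.group) auto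
    also have "\<dots> = card {c. c < k \<and> P (col c)}"
      by (simp add: sum.inter_filter[symmetric])
    finally show ?thesis .
  qed
  have "\<alpha> \<in> monomials d N k"
    using \<alpha>_sum[of "\<lambda>_. True"] col_index by (auto simp: monomials_def \<alpha>_def)
  moreover have "diagonal_exponent d N \<alpha> (i, l) = A (i, l)" for i l
  proof (cases "(i, l) \<in> grid d N")
    case False
    then show ?thesis using A diagonal_exponent_outside by (auto simp: exps_def)
  next
    case True
    then have il: "i < d" "l < N" by (auto simp: grid_def)
    have "diagonal_exponent d N \<alpha> (i, l) = card {c. c < k \<and> sorted_list_of_set (col c) ! i = l}"
      using il by (simp add: diagonal_exponent_def \<alpha>_sum)
    also have "{c. c < k \<and> sorted_list_of_set (col c) ! i = l} = {c. c < k \<and> T i c = l}"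
      using il sorted_col by auto
    also have "\<dots> = {(\<Sum>l'<l. A (i, l'))..<(\<Sum>l'\<le>l. A (i, l'))}"
    proof -
      have "(\<Sum>l'\<le>l. A (i, l')) \<le> (\<Sum>l'<N. A (i, l'))" using il by (intro sum_mono2) auto
      also have "\<dots> = k" using A il by (auto simp: exps_def)
      finally have hi: "(\<Sum>l'\<le>l. A (i, l')) \<le> k" .
      have "{c. c < k \<and> T i c = l} = {c. c < k \<and> (\<Sum>l'<l. A (i, l')) \<le> c \<and> c < (\<Sum>l'\<le>l. A (i, l'))}"
        by (intro Collect_cong conj_cong refl T_iff il)
      also have "\<dots> = {(\<Sum>l'<l. A (i, l'))..<(\<Sum>l'\<le>l. A (i, l'))}"
        using hi by auto
      finally show ?thesis .
    qed
    also have "card \<dots> = A (i, l)" by (simp add: lessThan_Suc_atMost[symmetric])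
    finally show ?thesis .
  qed
  ultimately show ?thesis by (auto intro!: bexI[of _ \<alpha>])
qed

text \<open>A right inverse \<open>f\<close> of \<open>diagonal_exponent\<close> on ballot exponents
  provides an independent family that attains the upper bound.\<close>

lemma coord_ring_dim_eq_card_ballot:
  "coord_ring_dim d N k = card {A \<in> exps d N k. ballot d N A}"
proof -
  let ?E = "{A \<in> exps d N k. ballot d N A}"
  obtain f where f: "\<And>A. A \<in> ?E \<Longrightarrow> f A \<in> monomials d N k"
    "\<And>A. A \<in> ?E \<Longrightarrow> diagonal_exponent d N (f A) = A"
    using ex_monomial_of_ballot[of _ d N k] by (metis (no_types, lifting) mem_Collect_eq)
  have "lin_indep_on d N (grass_cone d N) (f ` ?E)"
    using f by (intro lin_indep_of_inj_diagonal_exponent) (auto simp: inj_on_def)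
  moreover have "f ` ?E \<subseteq> monomials d N k" using f by auto
  moreover have "card (f ` ?E) = card ?E"
    by (intro card_image inj_on_inverseI[of _ "diagonal_exponent d N"] f(2))
  ultimately have mem: "card ?E \<in> {card M | M. M \<subseteq> monomials d N k \<and> lin_indep_on d N (grass_cone d N) M}"
    by (intro CollectI exI[of _ "f ` ?E"]) auto
  show ?thesis unfolding coord_ring_dim_def
  proof (rule Max_eqI)
    show "finite {card M | M. M \<subseteq> monomials d N k \<and> lin_indep_on d N (grass_cone d N) M}"
      by (rule finite_subset[of _ "card ` Pow (monomials d N k)"]) auto
  qed (use mem card_lin_indep_le in auto)
qed

section \<open>Counting ballot matrices\<close>

text \<open>Unequal row sums are allowed because removing the last column of a rectangular problem
  produces them.\<close>

definition ballot_rows :: "nat \<Rightarrow> nat \<Rightarrow> (nat \<Rightarrow> nat) \<Rightarrow> (nat \<times> nat \<Rightarrow> nat) set" where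
  "ballot_rows d N \<nu> = {A. (\<forall>x. x \<notin> grid d N \<longrightarrow> A x = 0) \<and> (\<forall>i<d. (\<Sum>l<N. A (i, l)) = \<nu> i) \<and> ballot d N A}"

lemma finite_ballot_rows [simp]: "finite (ballot_rows d N \<nu>)"
proof (rule finite_subset)
  let ?m = "\<Sum>i<d. \<nu> i"
  show "ballot_rows d N \<nu> \<subseteq> {A. \<forall>x. (x \<in> grid d N \<longrightarrow> A x \<in> {..?m}) \<and> (x \<notin> grid d N \<longrightarrow> A x = 0)}"
  proof (intro subsetI CollectI allI conjI impI)
    fix A x assume A: "A \<in> ballot_rows d N \<nu>" and "x \<in> grid d N"
    then obtain i l where x: "x = (i, l)" "i < d" "l < N" by (auto simp: grid_def)
    have "A (i, l) \<le> (\<Sum>l<N. A (i, l))" using x by (intro member_le_sum) auto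
    also have "\<dots> = \<nu> i" using A x by (auto simp: ballot_rows_def)
    also have "\<dots> \<le> ?m" using x by (intro member_le_sum) auto
    finally show "A x \<in> {..?m}" using x by simp
  qed (auto simp: ballot_rows_def)
  show "finite {A. \<forall>x. (x \<in> grid d N \<longrightarrow> A x \<in> {..?m}) \<and> (x \<notin> grid d N \<longrightarrow> A x = (0::nat))}"
    by (rule finite_set_of_finite_funs) auto
qed

text \<open>The only new condition is the one at \<open>j = N\<close>, where the left side is a full
  row sum.\<close>

lemma ballot_Suc:
  assumes "\<And>i. i < d \<Longrightarrow> (\<Sum>l<Suc N. A (i, l)) = \<nu> i"
  shows "ballot d (Suc N) A \<longleftrightarrow> ballot d N A \<and> (\<forall>r. Suc r < d \<longrightarrow> \<nu> (Suc r) \<le> (\<Sum>l<N. A (r, l)))"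
proof -
  have "(\<Sum>l\<le>N. A (Suc r, l)) = \<nu> (Suc r)" if "Suc r < d" for r
    using assms[OF that] by (simp add: lessThan_Suc_atMost)
  then show ?thesis by (auto simp: ballot_def less_Suc_eq)
qed

lemma ballot_cong:
  assumes "\<And>i l. i < d \<Longrightarrow> l < N \<Longrightarrow> A (i, l) = B (i, l)"
  shows "ballot d N A \<longleftrightarrow> ballot d N B"
proof -
  have "(\<Sum>l\<le>j. A (Suc r, l)) = (\<Sum>l\<le>j. B (Suc r, l))" "(\<Sum>l<j. A (r, l)) = (\<Sum>l<j. B (r, l))"
    if "Suc r < d" "j < N" for r j
    using that assms by (auto intro!: sum.cong)
  then show ?thesis by (simp add: ballot_def)
qed

text \<open>The shapes left when a horizontal strip is removed from \<open>\<nu>\<close>. Being a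
  product of intervals, the set turns sums of products over it into products of sums.\<close>

definition interlacing :: "nat \<Rightarrow> (nat \<Rightarrow> nat) \<Rightarrow> (nat \<Rightarrow> nat) set" where
  "interlacing d \<nu> = (\<Pi>\<^sub>E i\<in>{..<d}. {(if Suc i < d then \<nu> (Suc i) else 0)..\<nu> i})"

lemma interlacingD:
  assumes "\<mu> \<in> interlacing d \<nu>"
  shows "i < d \<Longrightarrow> \<mu> i \<le> \<nu> i" "Suc i < d \<Longrightarrow> \<nu> (Suc i) \<le> \<mu> i"
proof -
  have "\<mu> i \<in> {(if Suc i < d then \<nu> (Suc i) else 0)..\<nu> i}" if "i < d"
    using assms that unfolding interlacing_def PiE_iff by blast
  then show "i < d \<Longrightarrow> \<mu> i \<le> \<nu> i" "Suc i < d \<Longrightarrow> \<nu> (Suc i) \<le> \<mu> i" by simp_all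
qed

text \<open>Branching rule: classify by the row sums \<open>\<mu>\<close> without the last column;
  the deleted entries are then forced to be \<open>\<nu> i - \<mu> i\<close>.\<close>

lemma card_ballot_rows_Suc:
  "card (ballot_rows d (Suc N) \<nu>) = (\<Sum>\<mu>\<in>interlacing d \<nu>. card (ballot_rows d N \<mu>))"
proof -
  let ?S = "ballot_rows d (Suc N) \<nu>"
  \<comment> \<open>Restricted to \<open>{..<d}\<close> to match the extensional functions in
    \<open>interlacing\<close>.\<close>
  define \<phi> where "\<phi> A = restrict (\<lambda>i. \<Sum>l<N. A (i, l)) {..<d}" for A :: "nat \<times> nat \<Rightarrow> nat"
  have sub: "\<phi> ` ?S \<subseteq> interlacing d \<nu>"
  proof
    fix \<mu> assume "\<mu> \<in> \<phi> ` ?S"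
    then obtain A where A: "A \<in> ?S" "\<mu> = \<phi> A" by auto
    have rows: "(\<Sum>l<Suc N. A (i, l)) = \<nu> i" if "i < d" for i
      using A that by (simp add: ballot_rows_def)
    have "(\<Sum>l<N. A (i, l)) \<le> \<nu> i" if "i < d" for i using rows[OF that] by simp
    moreover have "\<nu> (Suc i) \<le> (\<Sum>l<N. A (i, l))" if "Suc i < d" for i
      using A that ballot_Suc[OF rows] by (auto simp: ballot_rows_def)
    ultimately show "\<mu> \<in> interlacing d \<nu>" by (auto simp: A(2) interlacing_def \<phi>_def)
  qed
  have fin: "finite (interlacing d \<nu>)" unfolding interlacing_def by (intro finite_PiE) auto
  have "card ?S = (\<Sum>\<mu>\<in>interlacing d \<nu>. \<Sum>A | A \<in> ?S \<and> \<phi> A = \<mu>. 1)"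
    by (subst sum.group) (use fin sub in auto)
  also have "\<dots> = (\<Sum>\<mu>\<in>interlacing d \<nu>. card (ballot_rows d N \<mu>))"
  proof (intro sum.cong refl)
    fix \<mu> assume \<mu>: "\<mu> \<in> interlacing d \<nu>"
    note \<mu>_le = interlacingD(1)[OF \<mu>] and \<mu>_ge = interlacingD(2)[OF \<mu>]
    have \<mu>_ext: "\<mu> i = undefined" if "\<not> i < d" for i
      using \<mu> that by (auto simp: interlacing_def PiE_def extensional_def)
    define f where "f A = (\<lambda>(i, l). if l = N then 0 else A (i, l))" for A :: "nat \<times> nat \<Rightarrow> nat"
    define f' where "f' A = (\<lambda>(i, l). if l = N \<and> i < d then \<nu> i - \<mu> i else A (i, l))" for A :: "nat \<times> nat \<Rightarrow> nat"
    have "bij_betw f {A. A \<in> ?S \<and> \<phi> A = \<mu>} (ballot_rows d N \<mu>)"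
    proof (rule bij_betw_byWitness[where f' = f'])
      show "\<forall>A\<in>{A. A \<in> ?S \<and> \<phi> A = \<mu>}. f' (f A) = A"
      proof
        fix A assume A: "A \<in> {A. A \<in> ?S \<and> \<phi> A = \<mu>}"
        have "\<nu> i - \<mu> i = A (i, N)" if "i < d" for i
        proof -
          have "(\<Sum>l<Suc N. A (i, l)) = \<nu> i" using A that by (simp add: ballot_rows_def)
          moreover have "\<mu> i = (\<Sum>l<N. A (i, l))" using A that by (auto simp: \<phi>_def)
          ultimately show ?thesis by simp
        qed
        moreover have "A (i, N) = 0" if "\<not> i < d" for i
          using A that by (auto simp: ballot_rows_def grid_def)
        ultimately show "f' (f A) = A" by (auto simp: f_def f'_def fun_eq_iff)
      qed
      show "\<forall>A\<in>ballot_rows d N \<mu>. f (f' A) = A"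
        by (auto simp: f_def f'_def fun_eq_iff ballot_rows_def grid_def)
      show "f ` {A. A \<in> ?S \<and> \<phi> A = \<mu>} \<subseteq> ballot_rows d N \<mu>"
      proof (intro image_subsetI)
        fix A assume A: "A \<in> {A. A \<in> ?S \<and> \<phi> A = \<mu>}"
        have rows: "(\<Sum>l<Suc N. A (i, l)) = \<nu> i" if "i < d" for i
          using A that by (simp add: ballot_rows_def)
        have "ballot d N A" using A ballot_Suc[OF rows] by (simp add: ballot_rows_def)
        then have "ballot d N (f A)" by (subst ballot_cong[of _ _ _ A]) (auto simp: f_def)
        moreover have "(\<Sum>l<N. f A (i, l)) = \<mu> i" if "i < d" for i
        proof -
          have "(\<Sum>l<N. f A (i, l)) = (\<Sum>l<N. A (i, l))" by (intro sum.cong) (auto simp: f_def)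
          also have "\<dots> = \<mu> i" using A that by (auto simp: \<phi>_def)
          finally show ?thesis .
        qed
        moreover have "f A x = 0" if "x \<notin> grid d N" for x
          using A that by (cases x) (auto simp: f_def ballot_rows_def grid_def)
        ultimately show "f A \<in> ballot_rows d N \<mu>" by (simp add: ballot_rows_def)
      qed
      show "f' ` ballot_rows d N \<mu> \<subseteq> {A. A \<in> ?S \<and> \<phi> A = \<mu>}"
      proof (intro image_subsetI)
        fix A assume A: "A \<in> ballot_rows d N \<mu>"
        have low: "(\<Sum>l<N. f' A (i, l)) = \<mu> i" if "i < d" for i
        proof -
          have "(\<Sum>l<N. f' A (i, l)) = (\<Sum>l<N. A (i, l))" by (intro sum.cong) (auto simp: f'_def)
          then show ?thesis using A that by (simp add: ballot_rows_def)
        qed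
        then have rows: "(\<Sum>l<Suc N. f' A (i, l)) = \<nu> i" if "i < d" for i
          using that \<mu>_le[OF that] by (simp add: f'_def)
        have "ballot d N (f' A)"
          using A by (subst ballot_cong[of _ _ _ A]) (auto simp: f'_def ballot_rows_def)
        then have "ballot d (Suc N) (f' A)" using low \<mu>_ge by (subst ballot_Suc[OF rows]) auto
        moreover have "f' A x = 0" if "x \<notin> grid d (Suc N)" for x
          using A that by (cases x) (auto simp: f'_def ballot_rows_def grid_def)
        moreover have "\<phi> (f' A) = \<mu>" using low \<mu>_ext by (auto simp: \<phi>_def fun_eq_iff)
        ultimately show "f' A \<in> {A. A \<in> ?S \<and> \<phi> A = \<mu>}" using rows by (simp add: ballot_rows_def)
      qed
    qed
    then show "(\<Sum>A | A \<in> ?S \<and> \<phi> A = \<mu>. 1) = card (ballot_rows d N \<mu>)"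
      using bij_betw_same_card by fastforce
  qed
  finally show ?thesis .
qed

text \<open>The complete homogeneous symmetric polynomial of degree \<open>m\<close> in \<open>N\<close> variables, evaluated at
  \<open>(1, \<dots>, 1)\<close>.\<close>

fun complete_hom :: "nat \<Rightarrow> int \<Rightarrow> complex" where
  "complete_hom 0 m = (if m = 0 then 1 else 0)"
| "complete_hom (Suc N) m = (if m < 0 then 0 else of_nat ((nat m + N) choose N))"

text \<open>Splitting off one variable set to 1; in binomials this is Pascal's rule.\<close>

lemma complete_hom_diff: "complete_hom (Suc N) m - complete_hom (Suc N) (m - 1) = complete_hom N m"
proof (cases "m > 0")
  case True
  then obtain k where m: "m = int (Suc k)" by (metis Suc_pred' nat_0_le order_less_le zero_less_nat_eq)
  then have nat: "nat m = Suc k" "nat (m - 1) = k" by auto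
  show ?thesis using True by (cases N) (simp_all add: nat)
next
  case False
  then show ?thesis by (cases N) auto
qed

lemma sum_complete_hom:
  assumes "a \<le> b"
  shows "(\<Sum>m=a..b. complete_hom N (int m + x)) =
    complete_hom (Suc N) (int b + x) - complete_hom (Suc N) (int a + x - 1)"
  using assms
proof (induction b rule: dec_induct)
  case base
  then show ?case by (simp add: complete_hom_diff del: complete_hom.simps)
next
  case (step b)
  then show ?case using complete_hom_diff[of N "int (Suc b) + x"]
    by (simp add: algebra_simps del: complete_hom.simps)
qed

section \<open>Jacobi-Trudi determinants\<close>

definition jacobi_trudi :: "nat \<Rightarrow> nat \<Rightarrow> (nat \<Rightarrow> nat) \<Rightarrow> complex mat" where
  "jacobi_trudi d N \<nu> = mat d d (\<lambda>(i, j). complete_hom N (int (\<nu> i) + (int j - int i)))"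

lemma det_upper_unitriangular:
  assumes "\<And>i j. j < i \<Longrightarrow> i < n \<Longrightarrow> f i j = 0" "\<And>i. i < n \<Longrightarrow> f i i = (1 :: 'a :: comm_ring_1)"
  shows "det (mat n n (\<lambda>(i, j). f i j)) = 1"
proof -
  have "det (mat n n (\<lambda>(i, j). f i j)) = prod_list (diag_mat (mat n n (\<lambda>(i, j). f i j)))"
    using assms by (intro det_upper_triangular[of _ n]) (auto simp: upper_triangular_def)
  also have "\<dots> = 1" using assms(2) by (auto simp: prod_list_diag_prod)
  finally show ?thesis .
qed

lemma det_lower_unitriangular:
  assumes "\<And>i j. i < j \<Longrightarrow> j < n \<Longrightarrow> f i j = 0" "\<And>i. i < n \<Longrightarrow> f i i = (1 :: 'a :: comm_ring_1)"
  shows "det (mat n n (\<lambda>(i, j). f i j)) = 1"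
proof -
  have "det (mat n n (\<lambda>(i, j). f i j)) = prod_list (diag_mat (mat n n (\<lambda>(i, j). f i j)))"
    using assms by (intro det_lower_triangular[of n]) auto
  also have "\<dots> = 1" using assms(2) by (auto simp: prod_list_diag_prod)
  finally show ?thesis .
qed

lemma mult_mat_mat:
  "mat n n (\<lambda>(i, j). f i j) * mat n n (\<lambda>(i, j). g i j) = mat n n (\<lambda>(i, j). \<Sum>t<n. f i t * g t j)"
  by (intro eq_matI) (auto simp: scalar_prod_def lessThan_atLeast0 intro!: sum.cong)

text \<open>By multilinearity the sum over \<open>\<mu>\<close> acts row by row. Each row telescopes
  to a difference of consecutive rows of the matrix for \<open>Suc N\<close>, which leaves the
  determinant unchanged.\<close>

lemma sum_det_jacobi_trudi:
  assumes dec: "\<And>i. Suc i < d \<Longrightarrow> \<nu> (Suc i) \<le> \<nu> i"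
  shows "(\<Sum>\<mu>\<in>interlacing d \<nu>. det (jacobi_trudi d N \<mu>)) = det (jacobi_trudi d (Suc N) \<nu>)"
proof -
  let ?P = "{p. p permutes {0..<d}}"
  let ?lb = "\<lambda>i. if Suc i < d then \<nu> (Suc i) else 0"
  define J where "J i j = complete_hom (Suc N) (int (\<nu> i) + (int j - int i))" for i j
  \<comment> \<open>Left multiplication by \<open>U\<close> subtracts from each row the next one;
    the last row stays.\<close>
  define U where "U i j = (if i = j then 1 else if j = Suc i then - 1 else 0 :: complex)" for i j :: nat
  have UJ: "(\<Sum>t<d. U i t * J t j) = (\<Sum>m=?lb i..\<nu> i. complete_hom N (int m + (int j - int i)))"
    if ij: "i < d" "j < d" for i j
  proof -
    have "(\<Sum>t<d. U i t * J t j) = (\<Sum>t<d. (if t = i then J i j else 0) - (if t = Suc i then J (Suc i) j else 0))"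
      by (intro sum.cong) (auto simp: U_def)
    also have "\<dots> = J i j - (if Suc i < d then J (Suc i) j else 0)"
      using ij by (simp add: sum_subtractf)
    \<comment> \<open>In the last row the lower bound is 0 and the argument \<open>j - d\<close> is
      negative, so the subtracted term is zero there.\<close>
    also have "(if Suc i < d then J (Suc i) j else 0) =
        complete_hom (Suc N) (int (?lb i) + (int j - int i) - 1)"
      using ij by (auto simp: J_def algebra_simps)
    also have "J i j - \<dots> = (\<Sum>m=?lb i..\<nu> i. complete_hom N (int m + (int j - int i)))"
      unfolding J_def using dec by (intro sum_complete_hom[symmetric]) auto
    finally show ?thesis .
  qed
  have lt: "p i < d" if "p \<in> ?P" "i < d" for p i
    using permutes_in_image[of p "{0..<d}" i] that by auto
  have "(\<Sum>\<mu>\<in>interlacing d \<nu>. det (jacobi_trudi d N \<mu>)) =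
      (\<Sum>\<mu>\<in>interlacing d \<nu>. \<Sum>p\<in>?P. of_int (sign p) *
        (\<Prod>i<d. complete_hom N (int (\<mu> i) + (int (p i) - int i))))"
    unfolding jacobi_trudi_def det_mat_eq ..
  also have "\<dots> = (\<Sum>p\<in>?P. of_int (sign p) *
      (\<Sum>\<mu>\<in>interlacing d \<nu>. \<Prod>i<d. complete_hom N (int (\<mu> i) + (int (p i) - int i))))"
    by (subst sum.swap) (simp add: sum_distrib_left)
  also have "\<dots> = (\<Sum>p\<in>?P. of_int (sign p) * (\<Prod>i<d. \<Sum>t<d. U i t * J t (p i)))"
  proof (intro sum.cong refl arg_cong2[where f = "(*)"])
    fix p assume p: "p \<in> ?P"
    have "(\<Sum>\<mu>\<in>interlacing d \<nu>. \<Prod>i<d. complete_hom N (int (\<mu> i) + (int (p i) - int i))) =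
        (\<Prod>i<d. \<Sum>m=?lb i..\<nu> i. complete_hom N (int m + (int (p i) - int i)))"
      unfolding interlacing_def by (intro prod_sum_PiE[symmetric]) auto
    also have "\<dots> = (\<Prod>i<d. \<Sum>t<d. U i t * J t (p i))"
      using lt[OF p] by (intro prod.cong refl UJ[symmetric]) auto
    finally show "(\<Sum>\<mu>\<in>interlacing d \<nu>. \<Prod>i<d. complete_hom N (int (\<mu> i) + (int (p i) - int i))) = \<dots>" .
  qed
  also have "\<dots> = det (mat d d (\<lambda>(i, j). U i j) * mat d d (\<lambda>(i, j). J i j))"
    unfolding mult_mat_mat det_mat_eq ..
  also have "\<dots> = det (mat d d (\<lambda>(i, j). U i j)) * det (mat d d (\<lambda>(i, j). J i j))"
    by (rule det_mult) auto
  also have "det (mat d d (\<lambda>(i, j). U i j)) = 1"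
    by (rule det_upper_unitriangular) (auto simp: U_def)
  finally show ?thesis by (simp add: jacobi_trudi_def J_def[abs_def])
qed

text \<open>Both sides obey the same branching recursion in \<open>N\<close>. Interlacing shapes are
  again decreasing, so the induction hypothesis applies to them.\<close>

lemma card_ballot_rows_eq_det:
  assumes "\<And>i. Suc i < d \<Longrightarrow> \<nu> (Suc i) \<le> \<nu> i"
  shows "of_nat (card (ballot_rows d N \<nu>)) = det (jacobi_trudi d N \<nu>)"
  using assms
proof (induction N arbitrary: \<nu>)
  case 0
  show ?case
  proof (cases "\<forall>i<d. \<nu> i = 0")
    case True
    then have "ballot_rows d 0 \<nu> = {\<lambda>_. 0}"
      by (auto simp: ballot_rows_def grid_def ballot_def fun_eq_iff)
    moreover have "jacobi_trudi d 0 \<nu> = 1\<^sub>m d"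
      using True by (intro eq_matI) (auto simp: jacobi_trudi_def)
    ultimately show ?thesis by simp
  next
    case False
    then obtain i where i: "i < d" "\<nu> i > 0" by auto
    then have "ballot_rows d 0 \<nu> = {}" by (auto simp: ballot_rows_def)
    \<comment> \<open>A nonzero shape has a nonzero first row, so every entry in row 0 of the matrix
      is \<open>complete_hom 0\<close> at a positive argument, hence zero.\<close>
    moreover have "\<nu> i \<le> \<nu> 0"
      using i(1)
    proof (induction i)
      case (Suc i)
      then show ?case using "0.prems"[of i] by simp
    qed simp
    then have "\<nu> 0 > 0" using i by simp
    then have "(\<Prod>i<d. complete_hom 0 (int (\<nu> i) + (int (p i) - int i))) = 0" for p
      using i by (intro prod_zero bexI[of _ 0]) auto
    then have "det (jacobi_trudi d 0 \<nu>) = 0" unfolding jacobi_trudi_def det_mat_eq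
      by (simp only: mult_zero_right sum.neutral_const)
    ultimately show ?thesis by simp
  qed
next
  case (Suc N)
  have "of_nat (card (ballot_rows d N \<mu>)) = det (jacobi_trudi d N \<mu>)" if \<mu>: "\<mu> \<in> interlacing d \<nu>" for \<mu>
  proof (rule Suc.IH)
    fix i assume i: "Suc i < d"
    show "\<mu> (Suc i) \<le> \<mu> i"
      using interlacingD[OF \<mu>] i by (meson order_trans)
  qed
  then show ?case using sum_det_jacobi_trudi[of d \<nu> N, OF Suc.prems] by (simp add: card_ballot_rows_Suc)
qed

text \<open>Vandermonde in the column index splits off the unitriangular factor \<open>P\<close>.
  The remaining \<open>M\<close> is \<open>Q\<close> up to row factors \<open>a\<close> and column
  factors \<open>b\<close>, and a second Vandermonde shows that \<open>Q\<close> has determinant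
  1.\<close>

lemma det_jacobi_trudi_rectangle:
  "det (jacobi_trudi d (n + d + 1) (\<lambda>_. k)) =
    (\<Prod>i<d. fact (k + n + d - i) / fact (k + d - 1 - i) * (fact (d - 1 - i) / fact (n + d - i)))"
proof -
  define M where "M i s = (of_nat ((k + n + d - i) choose (n + d - s)) :: complex)" for i s
  define P where "P s j = (of_nat (j choose s) :: complex)" for s j
  define Q where "Q i s = (of_nat ((k + d - 1 - i) choose (d - 1 - s)) :: complex)" for i s
  \<comment> \<open>The factors of \<open>Q\<close>. In spite of the letters, \<open>L\<close> is
    upper and \<open>U\<close> is lower unitriangular.\<close>
  define L where "L i t = (of_nat ((d - 1 - i) choose (d - 1 - t)) :: complex)" for i t
  define U where "U t s = (if s \<le> t then of_nat (k choose (t - s)) else 0 :: complex)" for t s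
  define a where "a i = (fact (k + n + d - i) / fact (k + d - 1 - i) :: complex)" for i
  define b where "b s = (fact (d - 1 - s) / fact (n + d - s) :: complex)" for s
  have MP: "complete_hom (n + d + 1) (int k + (int j - int i)) = (\<Sum>s<d. M i s * P s j)"
    if ij: "i < d" "j < d" for i j
  proof -
    have "complete_hom (n + d + 1) (int k + (int j - int i)) =
        of_nat ((j + (k + n + d - i)) choose (n + d))"
    proof (cases "int k + (int j - int i) < 0")
      case True
      then have "j + (k + n + d - i) < n + d" using ij by linarith
      then show ?thesis using True by (simp add: binomial_eq_0)
    next
      case False
      then have "nat (int k + (int j - int i)) + (n + d) = j + (k + n + d - i)" using ij by linarith
      then show ?thesis using False by simp
    qed
    also have "(j + (k + n + d - i)) choose (n + d) =
        (\<Sum>s\<le>n + d. (j choose s) * ((k + n + d - i) choose (n + d - s)))"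
      by (rule vandermonde[symmetric])
    also have "\<dots> = (\<Sum>s<d. (j choose s) * ((k + n + d - i) choose (n + d - s)))"
      using ij by (intro sum.mono_neutral_right) (auto simp: binomial_eq_0)
    finally show ?thesis by (simp add: M_def P_def mult.commute)
  qed
  have "jacobi_trudi d (n + d + 1) (\<lambda>_. k) = mat d d (\<lambda>(i, j). \<Sum>s<d. M i s * P s j)"
    unfolding jacobi_trudi_def using MP by (intro eq_matI) auto
  also have "\<dots> = mat d d (\<lambda>(i, j). M i j) * mat d d (\<lambda>(i, j). P i j)"
    by (rule mult_mat_mat[symmetric])
  also have "det \<dots> = det (mat d d (\<lambda>(i, j). M i j)) * det (mat d d (\<lambda>(i, j). P i j))"
    by (rule det_mult) auto
  also have "det (mat d d (\<lambda>(i, j). P i j)) = 1"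
    by (rule det_upper_unitriangular) (auto simp: P_def)
  also have "det (mat d d (\<lambda>(i, j). M i j)) =
      (\<Sum>p | p permutes {0..<d}. of_int (sign p) * ((\<Prod>i<d. Q i (p i)) * ((\<Prod>i<d. a i) * (\<Prod>i<d. b i))))"
    unfolding det_mat_eq
  proof (intro sum.cong refl arg_cong2[where f = "(*)"])
    fix p assume p: "p \<in> {p. p permutes {0..<d}}"
    \<comment> \<open>Both binomials have the same third factorial \<open>(k + s - i)!\<close>, so
      their quotient separates into a factor in \<open>i\<close> and a factor in
      \<open>s\<close>.\<close>
    have M: "M i s = Q i s * (a i * b s)" if is_lt: "i < d" "s < d" for i s
    proof (cases "d - 1 - s \<le> k + d - 1 - i")
      case True
      have le: "n + d - s \<le> k + n + d - i" using True is_lt by linarith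
      have eq: "k + n + d - i - (n + d - s) = k + d - 1 - i - (d - 1 - s)" using True is_lt by linarith
      show ?thesis
        unfolding M_def Q_def a_def b_def binomial_fact[OF True] binomial_fact[OF le] eq
        by (simp add: field_simps)
    next
      case False
      then have "k + n + d - i < n + d - s" using is_lt by linarith
      then show ?thesis using False by (simp add: M_def Q_def binomial_eq_0)
    qed
    have "p i < d" if "i < d" for i using permutes_in_image[of p "{0..<d}" i] that p by auto
    then have "(\<Prod>i<d. M i (p i)) = (\<Prod>i<d. Q i (p i)) * ((\<Prod>i<d. a i) * (\<Prod>i<d. b (p i)))"
      by (simp add: M prod.distrib)
    also have "(\<Prod>i<d. b (p i)) = (\<Prod>i<d. b i)"
      using prod.permute[of p "{..<d}" b] p by (simp add: lessThan_atLeast0 comp_def)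
    finally show "(\<Prod>i<d. M i (p i)) = (\<Prod>i<d. Q i (p i)) * ((\<Prod>i<d. a i) * (\<Prod>i<d. b i))" .
  qed
  also have "\<dots> = det (mat d d (\<lambda>(i, j). Q i j)) * ((\<Prod>i<d. a i) * (\<Prod>i<d. b i))"
    unfolding det_mat_eq by (simp add: sum_distrib_right mult.assoc)
  also have "mat d d (\<lambda>(i, j). Q i j) = mat d d (\<lambda>(i, j). \<Sum>t<d. L i t * U t j)"
  proof (intro eq_matI)
    fix i s assume "i < dim_row (mat d d (\<lambda>(i, j). \<Sum>t<d. L i t * U t j))"
      "s < dim_col (mat d d (\<lambda>(i, j). \<Sum>t<d. L i t * U t j))"
    then have lt: "i < d" "s < d" by auto
    have "k + d - 1 - i = (d - 1 - i) + k" using lt by linarith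
    then have "(k + d - 1 - i) choose (d - 1 - s) =
        (\<Sum>q\<le>d - 1 - s. ((d - 1 - i) choose q) * (k choose (d - 1 - s - q)))"
      by (simp only: vandermonde)
    also have "\<dots> = (\<Sum>t=s..d - 1. ((d - 1 - i) choose (d - 1 - t)) * (k choose (t - s)))"
      by (rule sum.reindex_bij_witness[where i = "\<lambda>t. d - 1 - t" and j = "\<lambda>q. d - 1 - q"])
        (use lt in \<open>auto simp: add.commute\<close>)
    also have "of_nat \<dots> = (\<Sum>t=s..d - 1. L i t * U t s)"
      unfolding of_nat_sum of_nat_mult by (intro sum.cong) (auto simp: L_def U_def)
    also have "\<dots> = (\<Sum>t<d. L i t * U t s)"
      using lt by (intro sum.mono_neutral_left) (auto simp: U_def)
    finally have "Q i s = (\<Sum>t<d. L i t * U t s)" by (simp add: Q_def)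
    then show "mat d d (\<lambda>(i, j). Q i j) $$ (i, s) = mat d d (\<lambda>(i, j). \<Sum>t<d. L i t * U t j) $$ (i, s)"
      using lt by simp
  qed auto
  also have "\<dots> = mat d d (\<lambda>(i, j). L i j) * mat d d (\<lambda>(i, j). U i j)"
    by (rule mult_mat_mat[symmetric])
  also have "det \<dots> = det (mat d d (\<lambda>(i, j). L i j)) * det (mat d d (\<lambda>(i, j). U i j))"
    by (rule det_mult) auto
  also have "det (mat d d (\<lambda>(i, j). L i j)) = 1"
    by (rule det_upper_unitriangular) (auto simp: L_def intro!: binomial_eq_0)
  also have "det (mat d d (\<lambda>(i, j). U i j)) = 1"
    by (rule det_lower_unitriangular) (auto simp: U_def)
  finally show ?thesis by (simp only: mult_1 mult_1_right a_def b_def prod.distrib)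
qed


section \<open>The Hilbert series\<close>

lemma fps_nth_funpow_deriv:
  fixes f :: "'a :: comm_semiring_1 fps"
  shows "fps_nth ((fps_deriv ^^ d) f) k = (\<Prod>i<d. of_nat (k + i + 1)) * fps_nth f (k + d)"
proof (induction d arbitrary: k)
  case (Suc d)
  have "(\<Prod>i<Suc d. of_nat (k + i + 1) :: 'a) = of_nat (k + 1) * (\<Prod>i<d. of_nat (k + 1 + i + 1))"
    by (subst prod.lessThan_Suc_shift) (simp add: add_ac)
  then show ?case by (simp add: Suc mult.assoc)
qed simp

text \<open>Multiplication by \<open>fps_X ^ (d - 1)\<close> followed by \<open>d\<close>
  derivatives moves coefficients by one place, since \<open>d \<ge> 1\<close>, and scales by
  \<open>d\<close> consecutive integers.\<close>

lemma fps_nth_funpow_deriv_shift: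
  fixes f :: "'a :: comm_ring_1 fps"
  assumes "d \<ge> 1"
  shows "fps_nth (((\<lambda>f. (fps_deriv ^^ d) (fps_X ^ (d - 1) * f)) ^^ n) f) k =
    (\<Prod>i<d. \<Prod>j<n. of_nat (k + j + i + 1)) * fps_nth f (k + n)"
proof (induction n arbitrary: k)
  case (Suc n)
  let ?g = "((\<lambda>f. (fps_deriv ^^ d) (fps_X ^ (d - 1) * f)) ^^ n) f"
  have "fps_nth (((\<lambda>f. (fps_deriv ^^ d) (fps_X ^ (d - 1) * f)) ^^ Suc n) f) k =
      (\<Prod>i<d. of_nat (k + i + 1)) * fps_nth (fps_X ^ (d - 1) * ?g) (k + d)"
    by (simp add: fps_nth_funpow_deriv)
  also have "fps_nth (fps_X ^ (d - 1) * ?g) (k + d) = fps_nth ?g (k + 1)"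
    using assms by (simp add: fps_X_power_mult_nth)
  also have "\<dots> = (\<Prod>i<d. \<Prod>j<n. of_nat (k + 1 + j + i + 1)) * fps_nth f (k + 1 + n)"
    by (rule Suc.IH)
  also have "(\<Prod>i<d. of_nat (k + i + 1)) * \<dots> =
      (\<Prod>i<d. of_nat (k + i + 1) * (\<Prod>j<n. of_nat (k + 1 + j + i + 1))) * fps_nth f (k + 1 + n)"
    by (simp only: prod.distrib mult.assoc)
  also have "(\<Prod>i<d. of_nat (k + i + 1) * (\<Prod>j<n. of_nat (k + 1 + j + i + 1) :: 'a)) =
      (\<Prod>i<d. \<Prod>j<Suc n. of_nat (k + j + i + 1))"
    by (simp only: prod.lessThan_Suc_shift comp_def) (simp add: add_ac)
  finally show ?case by simp
qed simp

lemma prod_shift_eq_fact_quotient: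
  "(\<Prod>j<n. of_nat (a + j + 1) :: 'a :: field_char_0) = fact (a + n) / fact a"
proof (induction n)
  case (Suc n)
  then show ?case by (simp add: mult.commute del: of_nat_Suc of_nat_add)
qed simp

text \<open>Constant row sums \<open>k\<close> give the rectangular determinant; reversing the index
  \<open>i\<close> to \<open>d - 1 - i\<close> makes the factorial arguments increase.\<close>

lemma hilbert_function_grass:
  "(of_nat (coord_ring_dim d (n + d + 1) k) :: complex) =
    (\<Prod>i<d. fact (k + n + 1 + i) / fact (k + i) * (fact i / fact (n + 1 + i)))"
proof -
  have "{A \<in> exps d (n + d + 1) k. ballot d (n + d + 1) A} = ballot_rows d (n + d + 1) (\<lambda>_. k)"
    by (auto simp: exps_def ballot_rows_def)
  then have "(of_nat (coord_ring_dim d (n + d + 1) k) :: complex) = det (jacobi_trudi d (n + d + 1) (\<lambda>_. k))"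
    by (simp only: coord_ring_dim_eq_card_ballot card_ballot_rows_eq_det)
  also have "\<dots> = (\<Prod>i<d. fact (k + n + d - i) / fact (k + d - 1 - i) * (fact (d - 1 - i) / fact (n + d - i)))"
    by (rule det_jacobi_trudi_rectangle)
  also have "\<dots> = (\<Prod>i<d. fact (k + n + 1 + i) / fact (k + i) * (fact i / fact (n + 1 + i)))"
  proof (rule prod.reindex_bij_witness[where i = "\<lambda>i. d - 1 - i" and j = "\<lambda>i. d - 1 - i"])
    fix i assume "i \<in> {..<d}"
    then have "k + n + 1 + (d - 1 - i) = k + n + d - i" "k + (d - 1 - i) = k + d - 1 - i"
      "n + 1 + (d - 1 - i) = n + d - i" by auto
    then show "fact (k + n + 1 + (d - 1 - i)) / fact (k + (d - 1 - i)) *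
        (fact (d - 1 - i) / fact (n + 1 + (d - 1 - i))) =
        (fact (k + n + d - i) / fact (k + d - 1 - i) * (fact (d - 1 - i) / fact (n + d - i)) :: complex)"
      by (simp only:)
  qed auto
  finally show ?thesis .
qed

text \<open>Coefficients are compared at each \<open>k\<close>: both sides become products over
  \<open>i < d\<close> of factorial quotients that agree factor by factor.\<close>

theorem theorem3p5:
  fixes d n :: nat
  assumes "d \<ge> 1"
  shows "hilbert_series_grass d (n + d + 1) =
    fps_const (1 / of_nat (\<Prod>i=1..d. \<Prod>j=1..n. i + j)) *
    (((\<lambda>f. (fps_deriv ^^ d) (fps_X ^ (d - 1) * f)) ^^ n)
       (inverse ((1 - fps_X) ^ (d + 1))))"
proof (rule fps_ext)
  fix k
  have "inverse ((1 - fps_X) ^ (d + 1) :: complex fps) = Abs_fps (\<lambda>k. of_nat ((d + 1 + k - 1) choose k))"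
    using one_minus_const_fps_X_neg_power'[of "d + 1" "1 :: complex"] by simp
  then have "fps_nth (inverse ((1 - fps_X) ^ (d + 1) :: complex fps)) (k + n) = of_nat ((k + n + d) choose (k + n))"
    by (simp add: add.commute)
  \<comment> \<open>The summand 0 brings the denominator \<open>fact d\<close> into the form of
    \<open>prod_shift_eq_fact_quotient\<close>.\<close>
  also have "\<dots> = (\<Prod>i<d. of_nat (k + n + i + 1)) / (\<Prod>i<d. of_nat (0 + i + 1))"
    unfolding prod_shift_eq_fact_quotient by (simp add: binomial_fact field_simps)
  also have "\<dots> = (\<Prod>i<d. of_nat (k + n + i + 1) / of_nat (i + 1))"
    by (simp add: prod_dividef)
  finally have inv: "fps_nth (inverse ((1 - fps_X) ^ (d + 1) :: complex fps)) (k + n) = \<dots>" .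
  have "(\<Prod>i=1..d. \<Prod>j=1..n. i + j) = (\<Prod>i<d. \<Prod>j<n. i + 1 + j + 1)"
    by (simp only: One_nat_def prod.atLeast1_atMost_eq lessThan_atLeast0) simp
  then have den: "(of_nat (\<Prod>i=1..d. \<Prod>j=1..n. i + j) :: complex) = (\<Prod>i<d. fact (i + 1 + n) / fact (i + 1))"
    by (simp only: of_nat_prod prod_shift_eq_fact_quotient)
  have num: "(\<Prod>i<d. \<Prod>j<n. of_nat (k + j + i + 1) :: complex) = (\<Prod>i<d. fact (k + i + n) / fact (k + i))"
    unfolding prod_shift_eq_fact_quotient[symmetric] by (simp add: add_ac)
  have "fps_nth (fps_const (1 / of_nat (\<Prod>i=1..d. \<Prod>j=1..n. i + j)) *
      (((\<lambda>f. (fps_deriv ^^ d) (fps_X ^ (d - 1) * f)) ^^ n) (inverse ((1 - fps_X) ^ (d + 1))))) k =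
      (\<Prod>i<d. 1 / (fact (i + 1 + n) / fact (i + 1)) * (fact (k + i + n) / fact (k + i) *
        (of_nat (k + n + i + 1) / of_nat (i + 1))) :: complex)"
    by (simp only: fps_mult_left_const_nth fps_nth_funpow_deriv_shift[OF assms] inv den num
        prod.distrib prod_dividef prod.neutral_const)
  also have "\<dots> = (\<Prod>i<d. fact (k + n + 1 + i) / fact (k + i) * (fact i / fact (n + 1 + i)))"
  proof (intro prod.cong refl)
    fix i
    have "fact (k + n + 1 + i) = (of_nat (k + n + i + 1) * fact (k + i + n) :: complex)"
      "fact (i + 1) = (of_nat (i + 1) * fact i :: complex)" "i + 1 + n = n + 1 + i"
      by (simp_all add: add_ac)
    then show "1 / (fact (i + 1 + n) / fact (i + 1)) * (fact (k + i + n) / fact (k + i) *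
        (of_nat (k + n + i + 1) / of_nat (i + 1))) =
        (fact (k + n + 1 + i) / fact (k + i) * (fact i / fact (n + 1 + i)) :: complex)"
      by (simp only:) (simp add: mult_ac del: of_nat_Suc of_nat_add fact_Suc)
  qed
  also have "\<dots> = fps_nth (hilbert_series_grass d (n + d + 1)) k"
    by (simp only: hilbert_series_grass_def hilbert_function_grass fps_nth_Abs_fps)
  finally show "fps_nth (hilbert_series_grass d (n + d + 1)) k =
    fps_nth (fps_const (1 / of_nat (\<Prod>i=1..d. \<Prod>j=1..n. i + j)) *
      (((\<lambda>f. (fps_deriv ^^ d) (fps_X ^ (d - 1) * f)) ^^ n) (inverse ((1 - fps_X) ^ (d + 1))))) k" ..
qed

end
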